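(* Let $\Sigma\subseteq\mathrm{PG}(4,q^5)$ be a canonical $\mathbb F_q$-subgeometry and $\Gamma$ a plane with $\Gamma\cap\Sigma=\emptyset$ such that $\mathbb L=\wp_\Gamma(\Sigma)$ is a maximum scattered linear set in $\mathrm{PG}(1,q^5)$ not of pseudoregulus type. Suppose that for every generator $\sigma$ of $\mathbb G$ the points $A=\Gamma\cap\Gamma^{\sigma^4}$ and $B=\Gamma\cap\Gamma^{\sigma^3}$ both have rank 4. Then $\mathbb L$ is equivalent (under $\mathrm{P\Gamma L}(2,q^5)$) to $$\mathbb E=\{\langle(\eta(x^q-x)+\mathrm{Tr}_{q^5/q}(\rho x),\ x^q-x^{q^4})\rangle_{\mathbb F_{q^5}}: x\in\mathbb F_{q^5}^*\}$$ for some $\eta,\rho\in\mathbb F_{q^5}$ with $\eta\neq0$ and $\mathrm{Tr}_{q^5/q}(\eta)=0\neq\mathrm{Tr}_{q^5/q}(\rho)$, or to $$L_F=\{\langle(x,F(x))\rangle_{\mathbb F_{q^5}}:x\in\mathbb F_{q^5}^*\},\qquad F(x)=k(x^q+x^{q^3})+x^{q^2}+x^{q^4},$$ for some $k\in\mathbb F_{q^5}$ with $\mathrm N_{q^5/q}(k)=1$.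
   Context: $q$ is a prime power; $\mathrm{Tr}_{q^5/q}(x)=\sum_{i=0}^4x^{q^i}$, $\mathrm N_{q^5/q}(x)=x^{1+q+q^2+q^3+q^4}$. An $\mathbb F_q$-linear set of rank 5 in $\mathrm{PG}(1,q^5)$ is $L_U=\{\langle v\rangle_{\mathbb F_{q^5}}:v\in U\setminus\{0\}\}$ for a 5-dimensional $\mathbb F_q$-subspace $U\subseteq\mathbb F_{q^5}^2$; it is maximum scattered if it has $(q^5-1)/(q-1)$ points; it is of pseudoregulus type if it is $\mathrm{P\Gamma L}(2,q^5)$-equivalent to $\{\langle(x,x^{q^s})\rangle_{\mathbb F_{q^5}}:x\in\mathbb F_{q^5}^*\}$ with $\gcd(s,5)=1$. A canonical $\mathbb F_q$-subgeometry of $\mathrm{PG}(4,q^5)$ is the image under a projectivity of the set of points having coordinates in $\mathbb F_q$. $\wp_\Gamma(\Sigma)$ is the projection of $\Sigma$ from $\Gamma$ onto a line disjoint from $\Gamma$. $\mathbb G$ is the subgroup of $\mathrm{P\Gamma L}(5,q^5)$ fixing $\Sigma$ pointwise (cyclic of order 5). Under these hypotheses $\Gamma\cap\Gamma^{\sigma^4}$ and $\Gamma\cap\Gamma^{\sigma^3}$ are single points. The rank of a point $X$ is $1+\dim\langle X,X^\sigma,\dots,X^{\sigma^4}\rangle$ (projective dimension). *)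

theory Defs
  imports "HOL-Analysis.Analysis" "HOL-Number_Theory.Prime_Powers"
begin

text \<open>
  The field with \<open>q ^ 5\<close> elements is a type \<open>'a :: {field, finite}\<close> with \<open>CARD('a) = q ^ 5\<close>.
  Projective points are the one-dimensional vector subspaces; a projective subspace
  is represented by the set of points it contains.
\<close>

subsection \<open>The finite field and its subfield of order \<open>q\<close>\<close>

definition Fq :: "nat \<Rightarrow> 'a::field set" where
  "Fq q = {x. x ^ q = x}"

definition Tr :: "nat \<Rightarrow> 'a::field \<Rightarrow> 'a" where
  "Tr q x = (\<Sum>i\<le>4. x ^ (q ^ i))"

definition Nm :: "nat \<Rightarrow> 'a::field \<Rightarrow> 'a" where
  "Nm q x = x ^ (1 + q + q ^ 2 + q ^ 3 + q ^ 4)"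

definition field_aut :: "('a::field \<Rightarrow> 'a) \<Rightarrow> bool" where
  "field_aut \<theta> \<longleftrightarrow> bij \<theta> \<and> (\<forall>x y. \<theta> (x + y) = \<theta> x + \<theta> y) \<and> (\<forall>x y. \<theta> (x * y) = \<theta> x * \<theta> y)"

subsection \<open>Projective spaces\<close>

definition pt :: "'a::field ^ 'n \<Rightarrow> ('a ^ 'n) set" where
  "pt v = vec.span {v}"

definition pg_points :: "('a::field ^ 'n) set set" where
  "pg_points = {pt v | v. v \<noteq> 0}"

definition pg_subspace :: "nat \<Rightarrow> ('a::field ^ 'n) set set \<Rightarrow> bool" where
  "pg_subspace k S \<longleftrightarrow>
    (\<exists>W. vec.subspace W \<and> vec.dim W = k + 1 \<and> S = {P \<in> pg_points. P \<subseteq> W})"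

definition pg_span :: "('a::field ^ 'n) set set \<Rightarrow> ('a ^ 'n) set set" where
  "pg_span S = {P \<in> pg_points. P \<subseteq> vec.span (\<Union>S)}"

text \<open>Projective dimension of the span of a set of points.\<close>

definition pg_dim :: "('a::field ^ 'n) set set \<Rightarrow> int" where
  "pg_dim S = int (vec.dim (\<Union>S)) - 1"

definition semilinear :: "('a::field \<Rightarrow> 'a) \<Rightarrow> ('a ^ 'm \<Rightarrow> 'a ^ 'n) \<Rightarrow> bool" where
  "semilinear \<theta> f \<longleftrightarrow>
    (\<forall>u v. f (u + v) = f u + f v) \<and> (\<forall>c v. f (c *s v) = \<theta> c *s f v)"

text \<open>
  The action of a vector space bijection on points. Extending it by the identity to
  sets of vectors that are not points makes two maps that act in the same way on
  points equal as functions, and composition the group operation.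
\<close>

definition induced :: "('a::field ^ 'n \<Rightarrow> 'a ^ 'n) \<Rightarrow> ('a ^ 'n) set \<Rightarrow> ('a ^ 'n) set" where
  "induced f P = (if P \<in> pg_points then f ` P else P)"

definition PGL :: "(('a::field ^ 'n) set \<Rightarrow> ('a ^ 'n) set) set" where
  "PGL = {induced f | f. semilinear id f \<and> bij f}"

definition PGammaL :: "(('a::field ^ 'n) set \<Rightarrow> ('a ^ 'n) set) set" where
  "PGammaL = {induced f | f \<theta>. field_aut \<theta> \<and> semilinear \<theta> f \<and> bij f}"

definition PGammaL_equiv :: "('a::field ^ 'n) set set \<Rightarrow> ('a ^ 'n) set set \<Rightarrow> bool" where
  "PGammaL_equiv S T \<longleftrightarrow> (\<exists>\<phi>\<in>PGammaL. \<phi> ` S = T)"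

subsection \<open>Subgeometries, projections and rank of a point\<close>

definition canonical_subgeometry :: "nat \<Rightarrow> ('a::field ^ 'n) set set \<Rightarrow> bool" where
  "canonical_subgeometry q S \<longleftrightarrow>
    (\<exists>\<phi>\<in>PGL. S = \<phi> ` {pt v | v. v \<noteq> 0 \<and> (\<forall>i. v $ i \<in> Fq q)})"

definition pointwise_stabilizer ::
    "('a::field ^ 'n) set set \<Rightarrow> (('a ^ 'n) set \<Rightarrow> ('a ^ 'n) set) set" where
  "pointwise_stabilizer S = {\<sigma> \<in> PGammaL. \<forall>P\<in>S. \<sigma> P = P}"

text \<open>
  The groups considered are finite, so the cyclic subgroup generated by an element consists
  of its powers with natural exponents.
\<close>

definition group_generator :: "('b \<Rightarrow> 'b) set \<Rightarrow> ('b \<Rightarrow> 'b) \<Rightarrow> bool" where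
  "group_generator G \<sigma> \<longleftrightarrow> \<sigma> \<in> G \<and> G = {\<sigma> ^^ i | i. True}"

definition pt_rank :: "(('a::field ^ 'n) set \<Rightarrow> ('a ^ 'n) set) \<Rightarrow> ('a ^ 'n) set \<Rightarrow> int" where
  "pt_rank \<sigma> X = 1 + pg_dim {(\<sigma> ^^ i) X | i. i \<le> 4}"

definition pg_projection ::
    "('a::field ^ 'n) set set \<Rightarrow> ('a ^ 'n) set set \<Rightarrow> ('a ^ 'n) set set \<Rightarrow> ('a ^ 'n) set set" where
  "pg_projection \<Gamma> \<Lambda> S = {Q. \<exists>P\<in>S. pg_span (insert P \<Gamma>) \<inter> \<Lambda> = {Q}}"

text \<open>
  A linear identification of the projective line with a line \<open>\<Lambda>\<close> of the ambient
  space, i.e. a choice of homogeneous coordinates on \<open>\<Lambda>\<close>.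
\<close>

definition line_coordinates :: "('a::field ^ 2 \<Rightarrow> 'a ^ 'n) \<Rightarrow> ('a ^ 'n) set set \<Rightarrow> bool" where
  "line_coordinates c \<Lambda> \<longleftrightarrow> semilinear id c \<and> inj c \<and> (\<lambda>P. c ` P) ` pg_points = \<Lambda>"

subsection \<open>Linear sets\<close>

definition Fq_span :: "nat \<Rightarrow> ('a::field ^ 'n) set \<Rightarrow> ('a ^ 'n) set" where
  "Fq_span q B = {(\<Sum>b\<in>B. c b *s b) | c. \<forall>b\<in>B. c b \<in> Fq q}"

definition Fq_independent :: "nat \<Rightarrow> ('a::field ^ 'n) set \<Rightarrow> bool" where
  "Fq_independent q B \<longleftrightarrow>
    (\<forall>c. (\<forall>b\<in>B. c b \<in> Fq q) \<and> (\<Sum>b\<in>B. c b *s b) = 0 \<longrightarrow> (\<forall>b\<in>B. c b = 0))"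

definition Fq_subspace :: "nat \<Rightarrow> nat \<Rightarrow> ('a::field ^ 'n) set \<Rightarrow> bool" where
  "Fq_subspace q d U \<longleftrightarrow>
    (\<exists>B. finite B \<and> card B = d \<and> Fq_independent q B \<and> U = Fq_span q B)"

definition linear_set :: "('a::field ^ 'n) set \<Rightarrow> ('a ^ 'n) set set" where
  "linear_set U = {pt v | v. v \<in> U - {0}}"

definition max_scattered :: "nat \<Rightarrow> ('a::field ^ 2) set set \<Rightarrow> bool" where
  "max_scattered q L \<longleftrightarrow>
    (\<exists>U. Fq_subspace q 5 U \<and> L = linear_set U) \<and> card L = (q ^ 5 - 1) div (q - 1)"

definition pseudoregulus_type :: "nat \<Rightarrow> ('a::field ^ 2) set set \<Rightarrow> bool" where
  "pseudoregulus_type q L \<longleftrightarrow>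
    (\<exists>s::nat. gcd s 5 = 1 \<and> PGammaL_equiv L {pt (vector [x, x ^ (q ^ s)]) | x. x \<noteq> 0})"

definition E_set :: "nat \<Rightarrow> 'a::field \<Rightarrow> 'a \<Rightarrow> ('a ^ 2) set set" where
  "E_set q \<eta> \<rho> =
    {pt (vector [\<eta> * (x ^ q - x) + Tr q (\<rho> * x), x ^ q - x ^ (q ^ 4)]) | x. x \<noteq> 0}"

definition F_map :: "nat \<Rightarrow> 'a::field \<Rightarrow> 'a \<Rightarrow> 'a" where
  "F_map q k x = k * (x ^ q + x ^ (q ^ 3)) + x ^ (q ^ 2) + x ^ (q ^ 4)"

definition LF_set :: "nat \<Rightarrow> 'a::field \<Rightarrow> ('a ^ 2) set set" where
  "LF_set q k = {pt (vector [x, F_map q k x]) | x. x \<noteq> 0}"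

end

theory Submission
  imports Defs
begin

text \<open>
  Let \<open>K\<close> be the field with \<open>q ^ 5\<close> elements, \<open>V\<close> the set of vectors of \<open>K ^ 5\<close> with entries in the
  subfield \<open>F\<close> of order \<open>q\<close>, \<open>s\<close> the coordinatewise \<open>q\<close>-th power map and \<open>G\<close> the three-dimensional
  space of \<open>\<Gamma>\<close>. If linear forms \<open>f, g\<close> have \<open>G\<close> as common kernel, then the projected linear set is
  projectively equivalent to the set of the points \<open>\<langle>(f v, g v)\<rangle>\<close> with \<open>v\<close> in \<open>V\<close>. Hence it suffices to
  find a linear form \<open>f\<close> that is bijective from \<open>V\<close> to \<open>K\<close> such that \<open>G\<close> is cut out by two explicit
  combinations of the forms \<open>s ^ j f\<close>.

  By maximum scatteredness, no nonzero linear form over \<open>F\<close> vanishes on \<open>G\<close>. If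
  \<open>G\<close> meets its image under \<open>s ^ 4\<close> or \<open>s ^ 3\<close> in more than a point, this forces \<open>G = \<langle>p, t p, t\<^sup>2 p\<rangle>\<close>
  for this power \<open>t\<close> of \<open>s\<close>, where \<open>p, \<dots>, t\<^sup>4 p\<close> is a basis, and the linear set is of pseudoregulus type.
  Otherwise \<open>A = \<langle>a\<rangle>\<close> and \<open>B = \<langle>b\<rangle>\<close> have rank 4, so they lie in hyperplanes over \<open>F\<close>. These differ, and
  both \<open>s a - a\<close> and \<open>s\<^sup>2 b - b\<close>, for suitably scaled \<open>a, b\<close>, span the intersection of \<open>G\<close> with both of
  them, so that \<open>s\<^sup>2 b - b = y (s a - a)\<close> for some scalar \<open>y\<close>. The configuration is determined by this
  relation: it gives \<open>L_F\<close> with \<open>k = y ^ (q\<^sup>2 - q\<^sup>3)\<close> if \<open>y\<close> is not in \<open>F\<close>, and \<open>E\<close> if it is.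
\<close>

subsection \<open>Frobenius and trace\<close>

text \<open>Multiplication by a nonzero \<open>x\<close> permutes the nonzero elements, so comparing
  their product before and after gives \<open>x ^ (CARD('a) - 1) = 1\<close>.\<close>

lemma finite_field_power_card:
  fixes x :: "'a::{field,finite}"
  shows "x ^ CARD('a) = x"
proof (cases "x = 0")
  case False
  have "(\<Prod>y\<in>UNIV-{0}. x * y) = (\<Prod>y\<in>UNIV-{0}. y)"
    by (rule prod.reindex_bij_witness[of _ "\<lambda>y. y / x" "\<lambda>y. x * y"]) (use False in auto)
  moreover have "(\<Prod>y\<in>UNIV-{0}. x * y) = x ^ (CARD('a) - 1) * \<Prod>(UNIV-{0})"
    by (simp add: prod.distrib)
  ultimately have "x ^ (CARD('a) - 1) = 1"
    by simp
  moreover have "x ^ CARD('a) = x * x ^ (CARD('a) - 1)"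
    by (metis One_nat_def Suc_pred power_Suc zero_less_card_finite)
  ultimately show ?thesis
    by simp
qed simp

text \<open>Adding 1 permutes the field, so the sum of all elements is unchanged although it grows
  by \<open>CARD('a)\<close> ones.\<close>

lemma of_nat_CARD_finite_field: "of_nat CARD('a) = (0::'a::{field,finite})"
proof -
  have "(\<Sum>y\<in>UNIV. y + 1) = (\<Sum>y\<in>(UNIV::'a set). y)"
    by (rule sum.reindex_bij_witness[of _ "\<lambda>y. y - 1" "\<lambda>y. y + 1"]) auto
  then show ?thesis
    by (simp add: sum.distrib)
qed

lemma card_le_degree_if_roots:
  fixes p :: "'a::idom poly"
  assumes "p \<noteq> 0" "\<And>x. x \<in> S \<Longrightarrow> poly p x = 0"
  shows "card S \<le> degree p"
proof -
  have "card S \<le> card {x. poly p x = 0}"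
    using assms by (intro card_mono poly_roots_finite) auto
  also have "\<dots> \<le> degree p"
    by (rule card_poly_roots_bound[OF assms(1)])
  finally show ?thesis .
qed

locale quintic_field =
  fixes q :: nat and K :: "'a::{field,finite} itself"
  assumes primepow_q: "primepow q" and card_K: "CARD('a) = q ^ 5"
begin

lemma q_ge_2: "q \<ge> 2"
  using primepow_gt_Suc_0[OF primepow_q] by simp

definition fr :: "nat \<Rightarrow> 'a \<Rightarrow> 'a" where
  "fr i x = x ^ (q ^ i)"

text \<open>The characteristic divides the order of the field, a power of the prime below
  \<open>q\<close>. This is what makes the \<open>q\<close>-th power map additive.\<close>

lemma q_eq_CHAR_power: "prime CHAR('a) \<and> (\<exists>n. q = CHAR('a) ^ n)"
proof
  show pr: "prime CHAR('a)"
    by (simp add: finite_imp_CHAR_pos prime_CHAR_semidom)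
  obtain p k where pk: "prime p" "q = p ^ k"
    using primepow_q by (auto simp: primepow_def)
  have "CHAR('a) dvd CARD('a)"
    using of_nat_CARD_finite_field of_nat_eq_0_iff_char_dvd by blast
  then have "CHAR('a) dvd p"
    using card_K pk pr prime_dvd_power by metis
  then show "\<exists>n. q = CHAR('a) ^ n"
    using pk pr by (metis primes_dvd_imp_eq)
qed

lemma fr_add [simp]: "fr i (x + y) = fr i x + fr i y"
proof -
  obtain n where "prime CHAR('a)" "q = CHAR('a) ^ n"
    using q_eq_CHAR_power by auto
  then show ?thesis
    unfolding fr_def by (intro freshmans_dream'[where n = "n * i"]) (auto simp: power_mult)
qed

lemma fr_0 [simp]: "fr i 0 = 0"
  using q_ge_2 by (simp add: fr_def)

lemma fr_1 [simp]: "fr i 1 = 1"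
  by (simp add: fr_def)

lemma fr_mult [simp]: "fr i (x * y) = fr i x * fr i y"
  by (simp add: fr_def power_mult_distrib)

lemma fr_minus [simp]: "fr i (- x) = - fr i x"
  using fr_add[of i x "- x"] by (simp del: fr_add add: eq_neg_iff_add_eq_0 add.commute)

lemma fr_diff [simp]: "fr i (x - y) = fr i x - fr i y"
  using fr_add[of i x "- y"] by simp

lemma fr_inverse [simp]: "fr i (inverse x) = inverse (fr i x)"
  by (simp add: fr_def power_inverse)

lemma fr_divide [simp]: "fr i (x / y) = fr i x / fr i y"
  by (simp add: fr_def power_divide)

lemma fr_power [simp]: "fr i (x ^ n) = fr i x ^ n"
  by (simp add: fr_def mult.commute flip: power_mult)

lemma fr_sum: "fr i (sum f A) = (\<Sum>x\<in>A. fr i (f x))"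
  by (induction A rule: infinite_finite_induct) auto

lemma fr_zero_exp [simp]: "fr 0 x = x"
  by (simp add: fr_def)

lemma fr_fr [simp]: "fr i (fr j x) = fr (i + j) x"
  by (simp add: fr_def power_add mult.commute flip: power_mult)

lemma fr_5 [simp]: "fr 5 x = x"
  using finite_field_power_card[of x] by (simp add: fr_def card_K)

lemma fr_plus_5: "fr (5 + i) x = fr i x"
  by (simp flip: fr_fr)

text \<open>Exponents matter only modulo 5; these are the unreduced ones that arise when exponents
  are added in the computations below.\<close>

lemma fr_reduce [simp]:
  "fr (Suc (Suc 0)) x = fr 2 x" "fr (Suc (Suc (Suc 0))) x = fr 3 x"
  "fr 6 x = fr 1 x" "fr 7 x = fr 2 x" "fr 8 x = fr 3 x" "fr 9 x = fr 4 x" "fr 10 x = x"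
  "fr 12 x = fr 2 x" "fr 16 x = fr 1 x"
  using fr_plus_5[of 1 x] fr_plus_5[of 2 x] fr_plus_5[of 3 x] fr_plus_5[of 4 x] fr_plus_5[of 5 x]
    fr_plus_5[of 7 x] fr_plus_5[of 11 x] fr_plus_5[of 6 x] by (simp_all add: numeral_2_eq_2[symmetric] numeral_3_eq_3[symmetric])

lemma fr_eq_0_iff [simp]: "fr i x = 0 \<longleftrightarrow> x = 0"
  using q_ge_2 by (simp add: fr_def)

lemma fr_inj [simp]: "fr i x = fr i y \<longleftrightarrow> x = y"
  using fr_eq_0_iff[of i "x - y"] by (simp del: fr_eq_0_iff)

abbreviation F :: "'a set" where "F \<equiv> Fq q"

lemma F_iff: "x \<in> F \<longleftrightarrow> fr 1 x = x"
  by (simp add: Fq_def fr_def)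

lemma fr_F: "x \<in> F \<Longrightarrow> fr i x = x"
proof (induction i)
  case (Suc i)
  then have "fr i (fr 1 x) = x"
    by (simp del: fr_fr add: F_iff)
  then show ?case by simp
qed simp

text \<open>Each of 1, 2, 3, 4 is invertible modulo 5, so some multiple of \<open>i\<close> is
  congruent to 1.\<close>

lemma fr_fixed_imp_F:
  assumes "fr i x = x" "i \<in> {1,2,3,4}"
  shows "x \<in> F"
proof -
  have "fr (2 * i) x = x" "fr (3 * i) x = x" "fr (4 * i) x = x"
    using assms(1) fr_fr[of i i x] fr_fr[of i "2*i" x] fr_fr[of i "3*i" x]
    by (simp_all add: numeral_eq_Suc)
  then show ?thesis
    using assms by (auto simp: F_iff)
qed

lemma F_closed [intro, simp]:
  "0 \<in> F" "1 \<in> F" "x \<in> F \<Longrightarrow> y \<in> F \<Longrightarrow> x + y \<in> F" "x \<in> F \<Longrightarrow> y \<in> F \<Longrightarrow> x * y \<in> F"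
  "x \<in> F \<Longrightarrow> - x \<in> F" "x \<in> F \<Longrightarrow> y \<in> F \<Longrightarrow> x - y \<in> F" "x \<in> F \<Longrightarrow> inverse x \<in> F"
  "x \<in> F \<Longrightarrow> y \<in> F \<Longrightarrow> x / y \<in> F"
  by (simp_all add: F_iff)

lemma F_sum: "(\<And>i. i \<in> A \<Longrightarrow> f i \<in> F) \<Longrightarrow> sum f A \<in> F"
  by (induction A rule: infinite_finite_induct) auto

abbreviation T :: "'a \<Rightarrow> 'a" where "T \<equiv> Tr q"

lemma T_eq: "T x = x + fr 1 x + fr 2 x + fr 3 x + fr 4 x"
proof -
  have "{..4} = {0, 1, 2, 3, 4::nat}" by auto
  then show ?thesis by (simp add: Tr_def fr_def add.assoc)
qed

lemma T_linear [simp]: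
  "T 0 = 0" "T (x + y) = T x + T y" "T (- x) = - T x" "T (x - y) = T x - T y"
  by (simp_all add: T_eq)

lemma T_F [simp]: "T x \<in> F"
  by (simp add: F_iff T_eq)

lemma T_scale: "c \<in> F \<Longrightarrow> T (c * x) = c * T x"
  by (simp add: T_eq fr_F algebra_simps)

lemma T_fr [simp]: "T (fr i x) = T x"
proof -
  have "T (fr 1 x) = T x" for x by (simp add: T_eq)
  then show ?thesis
    by (induction i arbitrary: x) (simp, metis Suc_eq_plus1 fr_fr)
qed

section \<open>The orders of the subfield and of the trace kernel\<close>

lemma card_F_le: "card F \<le> q"
proof -
  let ?p = "monom 1 q - monom 1 1 :: 'a poly"
  have "coeff ?p q = 1" using q_ge_2 by simp
  then have "?p \<noteq> 0" by (metis coeff_0 zero_neq_one)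
  then have "card F \<le> degree ?p"
    by (rule card_le_degree_if_roots) (auto simp: poly_monom Fq_def)
  also have "\<dots> \<le> q"
    using q_ge_2 by (intro degree_diff_le) (auto simp: degree_monom_le order.trans[OF degree_monom_le])
  finally show ?thesis .
qed

lemma card_ker_T_le: "card {x. T x = 0} \<le> q ^ 4"
proof -
  let ?p = "\<Sum>i\<le>4. monom 1 (q ^ i) :: 'a poly"
  have inj: "q ^ i = q ^ 4 \<longleftrightarrow> i = 4" for i :: nat
    using q_ge_2 by simp
  have "coeff ?p (q ^ 4) = 1"
    by (simp add: coeff_sum inj)
  then have "?p \<noteq> 0" by (metis coeff_0 zero_neq_one)
  then have "card {x. T x = 0} \<le> degree ?p"
    by (rule card_le_degree_if_roots) (auto simp: poly_monom poly_sum Tr_def)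
  also have "\<dots> \<le> q ^ 4"
    using q_ge_2
    by (intro degree_sum_le) (auto intro!: order.trans[OF degree_monom_le] power_increasing)
  finally show ?thesis .
qed

text \<open>The kernel of the trace has at most \<open>q ^ 4\<close> of the \<open>q ^ 5\<close>
  elements, and a nonzero value can be scaled to 1 over \<open>F\<close>.\<close>

lemma ex_T_eq_1: "\<exists>t. T t = 1"
proof -
  have "\<exists>t. T t \<noteq> 0"
  proof (rule ccontr)
    assume "\<not> ?thesis"
    then have "q ^ 5 \<le> q ^ 4" using card_ker_T_le card_K by simp
    then show False using q_ge_2 by simp
  qed
  then obtain t where "T t \<noteq> 0" by blast
  then have "T (inverse (T t) * t) = 1"
    by (subst T_scale) auto
  then show ?thesis by blast
qed

lemma T_nondegenerate:
  assumes "\<And>y. T (x * y) = 0"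
  shows "x = 0"
proof (rule ccontr)
  assume "x \<noteq> 0"
  moreover obtain t where "T t = 1" using ex_T_eq_1 by blast
  ultimately show False using assms[of "t / x"] by simp
qed

text \<open>The fibres of \<open>fr 1 x - x\<close> are no larger than \<open>F\<close>, and its
  image lies in the kernel of the trace; counting gives \<open>q ^ 5 \<le> q ^ 4 * card F\<close>.
  The other inequality counts roots of a polynomial of degree \<open>q\<close>.\<close>

lemma card_F: "card F = q"
proof -
  let ?u = "\<lambda>x. fr 1 x - x"
  have "q ^ 5 = card (\<Union>y\<in>range ?u. {x. ?u x = y})"
    by (simp add: card_K[symmetric] UNION_eq)
  also have "\<dots> \<le> (\<Sum>y\<in>range ?u. card {x. ?u x = y})"
    by (intro card_UN_le) auto
  also have "\<dots> \<le> (\<Sum>y\<in>range ?u. card F)"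
  proof (rule sum_mono)
    fix y assume "y \<in> range ?u"
    then obtain x0 where x0: "y = ?u x0" by blast
    have "(\<lambda>x. x - x0) ` {x. ?u x = y} \<subseteq> F"
      by (auto simp: F_iff x0 algebra_simps)
    then show "card {x. ?u x = y} \<le> card F"
      by (intro card_inj_on_le[of "\<lambda>x. x - x0"]) (auto simp: inj_on_def)
  qed
  also have "\<dots> = card (range ?u) * card F" by simp
  also have "\<dots> \<le> q ^ 4 * card F"
  proof (rule mult_right_mono)
    have "range ?u \<subseteq> {x. T x = 0}" by auto
    then show "card (range ?u) \<le> q ^ 4"
      using card_ker_T_le by (meson card_mono finite le_trans)
  qed simp
  finally have "q ^ 4 * q \<le> q ^ 4 * card F" by (simp add: eval_nat_numeral mult_ac)
  then have "q \<le> card F" using q_ge_2 by (simp only: mult_le_cancel1) auto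
  then show ?thesis using card_F_le by simp
qed

end

subsection \<open>Linear forms\<close>

text \<open>Linear forms are represented by their coefficient vectors, so that the Frobenius maps on
  forms and on vectors are the same function.\<close>

abbreviation dot :: "'a::field ^ 'n \<Rightarrow> 'a ^ 'n \<Rightarrow> 'a" where
  "dot \<equiv> scalar_product"

lemma dot_simps [simp]:
  "dot (x + y) z = dot x z + dot y z" "dot (x - y) z = dot x z - dot y z"
  "dot (c *s x) z = c * dot x z" "dot z (x + y) = dot z x + dot z y"
  "dot z (x - y) = dot z x - dot z y" "dot z (c *s x) = c * dot z x"
  "dot 0 z = 0" "dot z 0 = 0" "dot (- x) z = - dot x z" "dot z (- x) = - dot z x"
  for x y z :: "'a::field ^ 'n"
  by (simp_all add: scalar_product_def algebra_simps sum.distrib sum_subtractf sum_distrib_left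
      sum_negf)

lemma dot_commute: "dot x y = dot y x" for x y :: "'a::field ^ 'n"
  by (simp add: scalar_product_def mult.commute)

lemma dot_sum_right: "dot z (sum f A) = (\<Sum>i\<in>A. dot z (f i))" for z :: "'a::field ^ 'n"
  by (induction A rule: infinite_finite_induct) auto

lemma dot_axis: "dot x (axis k 1) = x $ k" for x :: "'a::field ^ 'n"
  by (simp add: scalar_product_def axis_def if_distrib cong: if_cong)

lemma sum_lessThan_3: "(\<Sum>i<3. f i) = f 0 + f 1 + f (2::nat)"
  for f :: "nat \<Rightarrow> 'b::comm_monoid_add"
  by (simp add: eval_nat_numeral)

lemma sum_lessThan_4: "(\<Sum>i<4. f i) = f 0 + f 1 + f 2 + f (3::nat)"
  for f :: "nat \<Rightarrow> 'b::comm_monoid_add"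
  by (simp add: eval_nat_numeral)

lemma sum_lessThan_5: "(\<Sum>i<5. f i) = f 0 + f 1 + f 2 + f 3 + f (4::nat)"
  for f :: "nat \<Rightarrow> 'b::comm_monoid_add"
  by (simp add: eval_nat_numeral)

text \<open>The family is indexed, so that a repeated vector counts as a dependence; this suits
  orbits of a vector under the Frobenius map.\<close>

definition lin_indep :: "nat \<Rightarrow> (nat \<Rightarrow> 'a::field ^ 'n) \<Rightarrow> bool" where
  "lin_indep n w \<longleftrightarrow> (\<forall>c. (\<Sum>i<n. c i *s w i) = 0 \<longrightarrow> (\<forall>i<n. c i = 0))"

lemma lin_indep_imp_inj_on:
  assumes "lin_indep n w"
  shows "inj_on w {..<n}"
proof (rule inj_onI, rule ccontr)
  fix i j assume ij: "i \<in> {..<n}" "j \<in> {..<n}" "w i = w j" "i \<noteq> j"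
  let ?c = "\<lambda>l. if l = i then 1 else if l = j then - 1 else 0"
  have "(\<Sum>l<n. ?c l *s w l) = (\<Sum>l\<in>{i, j}. ?c l *s w l)"
    using ij by (intro sum.mono_neutral_right) auto
  also have "\<dots> = 0" using ij by simp
  finally show False using assms[unfolded lin_indep_def, rule_format, of ?c i] ij by simp
qed

lemma lin_indep_imp_independent:
  assumes "lin_indep n w"
  shows "vec.independent (w ` {..<n})"
proof (rule vec.independent_if_scalars_zero)
  fix f x assume "(\<Sum>x\<in>w ` {..<n}. f x *s x) = 0" and x: "x \<in> w ` {..<n}"
  then have "(\<Sum>i<n. f (w i) *s w i) = 0"
    by (simp add: sum.reindex[OF lin_indep_imp_inj_on[OF assms]])
  then have "\<forall>i<n. f (w i) = 0"
    using assms[unfolded lin_indep_def, rule_format, of "\<lambda>i. f (w i)"] by simp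
  with x show "f x = 0" by auto
qed simp

text \<open>A span of dimension \<open>n\<close> forces the \<open>n\<close> vectors to be distinct,
  and a spanning set of that size is a basis.\<close>

lemma lin_indep_if_dim:
  assumes "vec.dim (w ` {..<n}) = n"
  shows "lin_indep n w"
  unfolding lin_indep_def
proof (intro allI impI)
  fix c i assume c: "(\<Sum>i<n. c i *s w i) = 0" and i: "i < n"
  have "card (w ` {..<n}) = n"
    using assms vec.dim_le_card'[of "w ` {..<n}"] card_image_le[of "{..<n}" w] by simp
  then have inj: "inj_on w {..<n}" by (intro eq_card_imp_inj_on) auto
  have "vec.independent (w ` {..<n})"
    using assms \<open>card _ = n\<close>
    by (intro vec.card_le_dim_spanning[where V = "w ` {..<n}"]) (auto simp: vec.span_superset)
  moreover have "(\<Sum>x\<in>w ` {..<n}. c (the_inv_into {..<n} w x) *s x) = 0"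
    using c by (simp add: sum.reindex[OF inj] the_inv_into_f_f[OF inj])
  ultimately have "c (the_inv_into {..<n} w (w i)) = 0"
    using i by (intro vec.independentD[of "w ` {..<n}" "w ` {..<n}" "\<lambda>x. c (the_inv_into {..<n} w x)"]) auto
  then show "c i = 0" using i by (simp add: the_inv_into_f_f[OF inj])
qed

lemma lin_indep_spans:
  assumes "lin_indep n w" "vec.subspace S" "vec.dim S \<le> n" "\<And>i. i < n \<Longrightarrow> w i \<in> S" "x \<in> S"
  shows "\<exists>c. x = (\<Sum>i<n. c i *s w i)"
proof -
  have "S \<subseteq> vec.span (w ` {..<n})"
    using assms lin_indep_imp_independent[OF assms(1)] lin_indep_imp_inj_on[OF assms(1)]
    by (intro vec.card_ge_dim_independent) (auto simp: card_image)
  then have "x \<in> vec.span (w ` {..<n})" using assms(5) by blast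
  then obtain u where "x = (\<Sum>v\<in>w ` {..<n}. u v *s v)"
    by (subst (asm) vec.span_finite) auto
  then show ?thesis
    by (auto simp: sum.reindex[OF lin_indep_imp_inj_on[OF assms(1)]])
qed

lemma lin_indep_4D:
  assumes "lin_indep 4 w" "c0 *s w 0 + c1 *s w 1 + c2 *s w 2 + c3 *s w 3 = 0"
  shows "c0 = 0 \<and> c1 = 0 \<and> c2 = 0 \<and> c3 = 0"
proof -
  let ?c = "\<lambda>i::nat. if i = 0 then c0 else if i = 1 then c1 else if i = 2 then c2 else c3"
  have "(\<Sum>i<4. ?c i *s w i) = 0" using assms(2) by (simp add: sum_lessThan_4)
  then have "\<forall>i<4. ?c i = 0" using assms(1)[unfolded lin_indep_def, rule_format, of ?c] by simp
  from this[rule_format, of 0] this[rule_format, of 1] this[rule_format, of 2] this[rule_format, of 3]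
  show ?thesis by simp
qed

text \<open>The values are extended to a linear map of the space into itself whose prescribed values
  lie on one axis. The index \<open>undefined\<close> is an arbitrary coordinate, from which the
  form is read off.\<close>

lemma functional_on_independent:
  assumes "vec.independent B"
  shows "\<exists>f::'a::field ^ 'n. \<forall>b\<in>B. dot f b = r b"
proof -
  obtain g :: "'a ^ 'n \<Rightarrow> 'a ^ 'n" where g: "Vector_Spaces.linear (*s) (*s) g"
    "\<And>b. b \<in> B \<Longrightarrow> g b = r b *s axis undefined 1"
    using vec.linear_independent_extend[OF assms, of "\<lambda>b. r b *s axis undefined 1"] by blast
  have "dot (\<chi> i. g (axis i 1) $ undefined) x = g x $ undefined" for x
    using linear_componentwise[OF g(1), of x undefined]
    by (simp add: scalar_product_def mult.commute)
  then show ?thesis using g(2) by (intro exI[of _ "\<chi> i. g (axis i 1) $ undefined"]) (simp add: axis_def)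
qed

lemma functional_prescribed:
  assumes "lin_indep n w"
  shows "\<exists>f::'a::field ^ 'n. \<forall>i<n. dot f (w i) = r i"
proof -
  have inj: "inj_on w {..<n}" by (rule lin_indep_imp_inj_on[OF assms])
  obtain f :: "'a ^ 'n" where "\<forall>b\<in>w ` {..<n}. dot f b = r (the_inv_into {..<n} w b)"
    using functional_on_independent[OF lin_indep_imp_independent[OF assms],
        where r = "\<lambda>b. r (the_inv_into {..<n} w b)"] by blast
  then show ?thesis by (intro exI[of _ f]) (auto simp: the_inv_into_f_f[OF inj])
qed

lemma functional_separating:
  fixes S :: "('a::field ^ 'n) set"
  assumes "vec.subspace S" "p \<notin> S"
  shows "\<exists>f. (\<forall>x\<in>S. dot f x = 0) \<and> dot f p = 1"
proof -
  obtain B where B: "B \<subseteq> S" "vec.independent B" "S \<subseteq> vec.span B" "card B = vec.dim S"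
    by (rule vec.basis_exists)
  have "vec.span B = S" using B assms(1) vec.span_subspace by blast
  then have "vec.independent (insert p B)" using B(2) assms(2) by (simp add: vec.independent_insert)
  from functional_on_independent[OF this, of "\<lambda>b. if b = p then 1 else 0"]
  obtain f where f: "\<forall>b\<in>insert p B. dot f b = (if b = p then 1 else 0)" by blast
  have "dot f x = 0" if "x \<in> S" for x
  proof -
    have "x \<in> vec.span B" using that B by blast
    then show ?thesis
      by (induction rule: vec.span_induct_alt) (use f B assms in auto)
  qed
  then show ?thesis using f by auto
qed

lemma subspace_dot_kernel: "vec.subspace {x. dot f x = 0}" for f :: "'a::field ^ 'n"
  by (auto simp: vec.subspace_def)

text \<open>The witnesses \<open>p\<close> and \<open>r\<close> make the two forms independent. A
  common zero \<open>x\<close> outside \<open>G\<close> would let \<open>G\<close> grow by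
  \<open>x\<close>, \<open>p\<close> and \<open>r\<close> in turn to dimension 6.\<close>

lemma common_kernel_eq:
  fixes G :: "('a::field ^ 5) set"
  assumes "vec.subspace G" "vec.dim G = 3" "\<And>x. x \<in> G \<Longrightarrow> dot f x = 0" "\<And>x. x \<in> G \<Longrightarrow> dot g x = 0"
    and "dot f p \<noteq> 0" "dot g p = 0" "dot g r \<noteq> 0"
  shows "x \<in> G \<longleftrightarrow> dot f x = 0 \<and> dot g x = 0"
proof (rule iffI, use assms in blast, rule ccontr)
  assume x: "dot f x = 0 \<and> dot g x = 0" and "x \<notin> G"
  then have "vec.dim (insert x G) = 4"
    using assms(1,2) by (simp add: vec.dim_insert vec.span_eq_iff[THEN iffD2])
  moreover have "p \<notin> vec.span (insert x G)"
  proof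
    assume "p \<in> vec.span (insert x G)"
    moreover have "vec.span (insert x G) \<subseteq> {x. dot f x = 0}"
      using x assms by (intro vec.span_minimal subspace_dot_kernel) auto
    ultimately show False using assms by auto
  qed
  ultimately have "vec.dim (insert p (insert x G)) = 5" by (simp add: vec.dim_insert)
  moreover have "r \<notin> vec.span (insert p (insert x G))"
  proof
    assume "r \<in> vec.span (insert p (insert x G))"
    moreover have "vec.span (insert p (insert x G)) \<subseteq> {x. dot g x = 0}"
      using x assms by (intro vec.span_minimal subspace_dot_kernel) auto
    ultimately show False using assms by auto
  qed
  ultimately have "vec.dim (insert r (insert p (insert x G))) = 6" by (simp add: vec.dim_insert)
  then show False
    using dim_subset_UNIV_cart_gen[of "insert r (insert p (insert x G))"] by simp
qed

lemma lin_indep_scale: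
  assumes "lin_indep n w" "\<And>i. i < n \<Longrightarrow> d i \<noteq> 0"
  shows "lin_indep n (\<lambda>i. d i *s w i)"
  unfolding lin_indep_def
proof (intro allI impI)
  fix c i assume "(\<Sum>i<n. c i *s (d i *s w i)) = 0" "i < n"
  then have "c i * d i = 0"
    using assms(1)[unfolded lin_indep_def, rule_format, of "\<lambda>i. c i * d i" i] by simp
  then show "c i = 0" using assms(2) \<open>i < n\<close> by simp
qed

text \<open>Applying \<open>t\<close> to a linear relation isolates its last coefficient.\<close>

lemma lin_indep_Suc:
  assumes "lin_indep n w" "\<And>i. i < n \<Longrightarrow> dot t (w i) = 0" "dot t (w n) \<noteq> 0"
  shows "lin_indep (Suc n) w"
  unfolding lin_indep_def
proof (intro allI impI)
  fix c i assume c: "(\<Sum>i<Suc n. c i *s w i) = 0" and i: "i < Suc n"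
  have "dot t (\<Sum>i<Suc n. c i *s w i) = c n * dot t (w n)"
    using assms(2) by (simp add: dot_sum_right)
  then have "c n * dot t (w n) = 0" unfolding c by simp
  then have "c n = 0" using assms(3) by simp
  then have "\<forall>i<n. c i = 0"
    using c assms(1)[unfolded lin_indep_def, rule_format, of c] by simp
  then show "c i = 0" using \<open>c n = 0\<close> i less_Suc_eq by auto
qed

text \<open>Bases of the plane are taken in this shape: two vectors in a hyperplane and one outside
  it.\<close>

lemma lin_indep_triple:
  assumes "\<And>c d. c *s x + d *s y = 0 \<Longrightarrow> c = 0 \<and> d = 0"
    and "dot t x = 0" "dot t y = 0" "dot t z \<noteq> 0"
  shows "lin_indep 3 (\<lambda>i::nat. if i = 0 then x else if i = 1 then y else z)" (is "lin_indep 3 ?w")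
proof -
  have "lin_indep 2 ?w"
    unfolding lin_indep_def
  proof (intro allI impI)
    fix c and i :: nat
    assume "(\<Sum>i<2. c i *s ?w i) = 0" "i < 2"
    then have "c 0 *s x + c 1 *s y = 0" by (simp add: numeral_2_eq_2)
    then have "c 0 = 0 \<and> c 1 = 0" by (rule assms(1))
    moreover have "i = 0 \<or> i = 1" using \<open>i < 2\<close> by linarith
    ultimately show "c i = 0" by auto
  qed
  moreover have "dot t (?w i) = 0" if "i < 2" for i using that assms by simp
  ultimately have "lin_indep (Suc 2) ?w" using assms by (intro lin_indep_Suc[where t = t]) auto
  then show ?thesis by (simp add: numeral_3_eq_3 numeral_2_eq_2)
qed

subsection \<open>Frobenius on vectors and rational vectors\<close>

context quintic_field
begin

definition sg :: "nat \<Rightarrow> 'a ^ 'n \<Rightarrow> 'a ^ 'n" where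
  "sg i w = (\<chi> k. fr i (w $ k))"

lemma sg_nth [simp]: "sg i w $ k = fr i (w $ k)"
  by (simp add: sg_def)

lemma sg_simps [simp]:
  "sg i (x + y) = sg i x + sg i y" "sg i (x - y) = sg i x - sg i y" "sg i (c *s x) = fr i c *s sg i x"
  "sg i 0 = 0" "sg i (- x) = - sg i x" "sg 0 x = x" "sg i (sg j x) = sg (i + j) x" "sg 5 x = x"
  "sg (Suc (Suc 0)) x = sg 2 x" "sg (Suc (Suc (Suc 0))) x = sg 3 x"
  "sg 6 x = sg 1 x" "sg 7 x = sg 2 x" "sg 8 x = sg 3 x" "sg 9 x = sg 4 x" "sg 10 x = x"
  "sg 12 x = sg 2 x" "sg 16 x = sg 1 x" "sg i x = 0 \<longleftrightarrow> x = 0"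
  by (simp_all add: vec_eq_iff)

lemma dot_sg: "dot (sg i x) (sg i y) = fr i (dot x y)"
  by (simp add: scalar_product_def fr_sum)

text \<open>Moves the Frobenius map from the form to its argument; the exponents 1 and 4, and 2 and
  3, are opposite modulo 5.\<close>

lemma dot_sg_left:
  "dot (sg 1 f) w = fr 1 (dot f (sg 4 w))" "dot (sg 2 f) w = fr 2 (dot f (sg 3 w))"
  "dot (sg 3 f) w = fr 3 (dot f (sg 2 w))" "dot (sg 4 f) w = fr 4 (dot f (sg 1 w))"
  using dot_sg[of 1 f "sg 4 w"] dot_sg[of 2 f "sg 3 w"] dot_sg[of 3 f "sg 2 w"] dot_sg[of 4 f "sg 1 w"]
  by simp_all

definition V :: "('a ^ 'n) set" where
  "V = {v. \<forall>k. v $ k \<in> F}"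

lemma V_iff: "v \<in> V \<longleftrightarrow> sg 1 v = v"
  by (simp add: V_def vec_eq_iff F_iff)

lemma sg_V: "v \<in> V \<Longrightarrow> sg i v = v"
  by (simp add: V_def vec_eq_iff fr_F)

lemma V_closed: "0 \<in> V" "x \<in> V \<Longrightarrow> y \<in> V \<Longrightarrow> x + y \<in> V" "x \<in> V \<Longrightarrow> y \<in> V \<Longrightarrow> x - y \<in> V"
  "c \<in> F \<Longrightarrow> x \<in> V \<Longrightarrow> c *s x \<in> V"
  by (auto simp: V_def)

lemma dot_V_F: "x \<in> V \<Longrightarrow> y \<in> V \<Longrightarrow> dot x y \<in> F"
  by (auto simp: scalar_product_def V_def intro!: F_sum)

lemma dot_V_sg: "t \<in> V \<Longrightarrow> dot t (sg i w) = fr i (dot t w)"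
  using dot_sg[of i t w] by (simp add: sg_V)

lemma dot_sg_V: "v \<in> V \<Longrightarrow> dot (sg i f) v = fr i (dot f v)"
  using dot_sg[of i f v] by (simp add: sg_V)

lemma card_V: "card (V :: ('a ^ 5) set) = q ^ 5"
proof -
  have "bij_betw vec_lambda (PiE (UNIV :: 5 set) (\<lambda>_. F)) V"
    by (rule bij_betwI[of _ _ _ vec_nth]) (auto simp: V_def vec_lambda_inverse vec_nth_inverse)
  then have "card (V :: ('a ^ 5) set) = card (PiE (UNIV :: 5 set) (\<lambda>_. F))"
    by (simp add: bij_betw_same_card)
  also have "\<dots> = q ^ 5" by (simp add: card_PiE card_F)
  finally show ?thesis .
qed

text \<open>The coordinatewise trace. It is the device that produces vectors of \<open>V\<close>,
  and thereby forms with coefficients in \<open>F\<close>.\<close>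

definition TV :: "'a ^ 'n \<Rightarrow> 'a ^ 'n" where
  "TV w = w + sg 1 w + sg 2 w + sg 3 w + sg 4 w"

lemma TV_simps [simp]: "TV (x + y) = TV x + TV y" "TV (x - y) = TV x - TV y" "TV 0 = 0"
  by (simp_all add: TV_def)

lemma TV_sg [simp]: "TV (sg i w) = TV w"
proof -
  have "TV (sg 1 w) = TV w" for w :: "'a ^ 'n" by (simp add: TV_def)
  then have "TV (sg (Suc i) w) = TV (sg i w)" for i
    using \<open>TV (sg 1 (sg i w)) = TV (sg i w)\<close> by simp
  then show ?thesis by (induction i) auto
qed

lemma TV_in_V [simp]: "TV w \<in> V"
  by (simp add: V_iff TV_def)

lemma TV_nth: "TV w $ k = T (w $ k)"
  by (simp add: TV_def T_eq)

lemma TV_scale_V: "v \<in> V \<Longrightarrow> TV (x *s v) = T x *s v"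
  by (simp add: TV_def T_eq sg_V vec_eq_iff algebra_simps)

lemma TV_scale_F: "c \<in> F \<Longrightarrow> TV ((c * x) *s w) = c *s TV (x *s w)"
  by (simp add: vec_eq_iff TV_nth mult.assoc T_scale)

lemma dot_V_TV: "t \<in> V \<Longrightarrow> dot t (TV w) = T (dot t w)"
  by (simp add: TV_def dot_V_sg T_eq)

section \<open>Rational points and rational hyperplanes\<close>

lemma ex_TV_nonzero:
  assumes "w \<noteq> 0"
  shows "\<exists>x. TV (x *s w) \<noteq> 0"
proof -
  obtain k where k: "w $ k \<noteq> 0" using assms by (auto simp: vec_eq_iff)
  obtain t where "T t = 1" using ex_T_eq_1 by blast
  then have "TV ((t / w $ k) *s w) $ k = 1" using k by (simp add: TV_nth)
  then have "TV ((t / w $ k) *s w) \<noteq> 0" by (auto simp: vec_eq_iff intro!: exI[of _ k])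
  then show ?thesis by blast
qed

text \<open>A subspace stable under the Frobenius map contains the traces of its vectors, and some
  multiple of \<open>w\<close> has nonzero trace.\<close>

lemma invariant_subspace_meets_V:
  assumes "vec.subspace S" "\<And>x. x \<in> S \<Longrightarrow> sg 1 x \<in> S" "w \<in> S" "w \<noteq> 0"
  shows "\<exists>v\<in>S \<inter> V. v \<noteq> 0"
proof -
  obtain x where x: "TV (x *s w) \<noteq> 0" using ex_TV_nonzero[OF assms(4)] by blast
  have "x *s w \<in> S" using assms by (simp add: vec.subspace_scale)
  moreover have "sg i y \<in> S" if "y \<in> S" for i y
    proof (induction i)
    case (Suc i)
    then show ?case using assms(2)[of "sg i y"] by simp
  qed (simp add: that)
  ultimately have "TV (x *s w) \<in> S"
    unfolding TV_def by (intro vec.subspace_add assms(1)) (auto simp del: sg_simps(3))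
  then show ?thesis using x by auto
qed

text \<open>If \<open>f\<close> kills all conjugates of \<open>w\<close>, then all conjugates of
  multiples of \<open>f\<close> kill \<open>w\<close>; a nonzero trace of a multiple of
  \<open>f\<close> is the desired form over \<open>F\<close>.\<close>

lemma rational_functional:
  assumes "f \<noteq> 0" "dot f w = 0" "dot f (sg 1 w) = 0" "dot f (sg 2 w) = 0" "dot f (sg 3 w) = 0"
    "dot f (sg 4 w) = 0"
  shows "\<exists>t\<in>V. t \<noteq> 0 \<and> dot t w = 0"
proof -
  obtain x where x: "TV (x *s f) \<noteq> 0" using ex_TV_nonzero[OF assms(1)] by blast
  have "dot (TV (x *s f)) w = 0"
    using assms by (simp add: TV_def dot_sg_left[unfolded One_nat_def])
  then show ?thesis using x by auto
qed

text \<open>If no such \<open>m\<close> existed, then by counting all of \<open>V\<close> would be of the form \<open>TV (m *s w)\<close>, hence killed by \<open>t\<close>.\<close>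

lemma trace_relation:
  fixes w :: "'a ^ 5"
  assumes t: "t \<in> V" "t \<noteq> 0" "dot t w = 0"
  shows "\<exists>m. m \<noteq> 0 \<and> TV (m *s w) = 0"
proof (rule ccontr)
  assume *: "\<not> ?thesis"
  have "inj (\<lambda>m. TV (m *s w))"
  proof (rule injI)
    fix x y assume "TV (x *s w) = TV (y *s w)"
    then have "TV ((x - y) *s w) = 0" by (simp add: vec.scale_left_diff_distrib)
    then have "x - y = 0" using * by blast
    then show "x = y" by simp
  qed
  then have "card (range (\<lambda>m. TV (m *s w))) = card (V :: ('a ^ 5) set)"
    by (simp add: card_image card_V card_K)
  then have "range (\<lambda>m. TV (m *s w)) = V"
    by (intro card_subset_eq) auto
  then have range_eq: "V = range (\<lambda>m. TV (m *s w))" ..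
  have *: "dot t v = 0" if v: "v \<in> V" for v
  proof -
    obtain m where "v = TV (m *s w)" using v unfolding range_eq by blast
    then show ?thesis using t by (simp add: dot_V_TV)
  qed
  obtain k where "t $ k \<noteq> 0" using t(2) by (auto simp: vec_eq_iff)
  moreover have "axis k 1 \<in> V" by (auto simp: V_def axis_def)
  ultimately show False using *[of "axis k 1"] by (simp add: dot_axis)
qed

text \<open>Writing \<open>v = TV (t *s v)\<close> with \<open>T t = 1\<close> turns an arbitrary combination of the orbit of \<open>w\<close> into a trace.\<close>

lemma rational_combination_eq_TV:
  assumes "v \<in> V" "v = (\<Sum>j<5. y j *s sg j w)"
  shows "\<exists>x. v = TV (x *s w)"
proof -
  obtain t where t: "T t = 1" using ex_T_eq_1 by blast
  have *: "TV (z *s sg j w) = TV (fr (5 - j) z *s w)" if "j < 5" for z j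
  proof -
    have "z *s sg j w = sg j (fr (5 - j) z *s w)" using that by simp
    then show ?thesis by (simp only: TV_sg)
  qed
  have "v = TV (t *s v)" using t assms(1) by (simp add: TV_scale_V)
  also have "t *s v = (\<Sum>j<5. (t * y j) *s sg j w)"
    by (subst assms(2)) (simp add: vec.scale_sum_right)
  also have "TV \<dots> = TV ((\<Sum>j<5. fr (5 - j) (t * y j)) *s w)"
    using *[of 0 "t * y 0"] *[of 1 "t * y 1"] *[of 2 "t * y 2"] *[of 3 "t * y 3"] *[of 4 "t * y 4"]
    by (simp only: sum_lessThan_5 TV_simps vec.scale_left_distrib)
  finally show ?thesis by blast
qed

section \<open>Conjugate subspaces and orbits of vectors\<close>

lemma inj_sg: "inj (sg i)"
  by (rule injI) (simp add: vec_eq_iff)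

lemma dim_sg_image_le: "vec.dim (sg i ` S) \<le> vec.dim S"
proof -
  obtain B where B: "B \<subseteq> S" "vec.independent B" "S \<subseteq> vec.span B" "card B = vec.dim S"
    by (rule vec.basis_exists)
  have fin: "finite B" using B(2) vec.finiteI_independent by blast
  have "sg i x \<in> vec.span (sg i ` B)" if "x \<in> vec.span B" for x
    using that
  proof (induction rule: vec.span_induct_alt)
    case (step c x y)
    then have "sg i x \<in> vec.span (sg i ` B)" by (intro vec.span_base) auto
    then show ?case using step by (auto intro: vec.span_add vec.span_scale)
  qed (simp add: vec.span_zero)
  then have "sg i ` S \<subseteq> vec.span (sg i ` B)" using B(3) by blast
  then have "vec.dim (sg i ` S) \<le> card (sg i ` B)"
    using fin by (intro vec.dim_le_card) auto
  also have "\<dots> \<le> card B" using fin by (rule card_image_le)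
  finally show ?thesis using B(4) by simp
qed

lemma dim_sg_image:
  assumes "i \<le> 5"
  shows "vec.dim (sg i ` S) = vec.dim S"
proof -
  have "sg (5 - i) ` sg i ` S = S" using assms by (simp add: image_image)
  then show ?thesis using dim_sg_image_le[of i S] dim_sg_image_le[of "5 - i" "sg i ` S"] by simp
qed

lemma subspace_sg_image:
  assumes "vec.subspace S" "i \<le> 5"
  shows "vec.subspace (sg i ` S)"
proof (rule vec.subspaceI)
  show "0 \<in> sg i ` S" using vec.subspace_0[OF assms(1)] by (force simp: image_iff)
next
  fix x y assume "x \<in> sg i ` S" "y \<in> sg i ` S"
  then obtain x' y' where "x = sg i x'" "x' \<in> S" "y = sg i y'" "y' \<in> S" by blast
  then show "x + y \<in> sg i ` S"
    using vec.subspace_add[OF assms(1)] by (intro image_eqI[of _ _ "x' + y'"]) auto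
next
  fix c x assume "x \<in> sg i ` S"
  then obtain x' where "x = sg i x'" "x' \<in> S" by blast
  then show "c *s x \<in> sg i ` S"
    using vec.subspace_scale[OF assms(1)] assms(2)
    by (intro image_eqI[of _ _ "fr (5 - i) c *s x'"]) auto
qed

text \<open>If the orbit of \<open>w\<close> lay in a hyperplane, \<open>rational_functional\<close>
  would give a hyperplane over \<open>F\<close> through \<open>w\<close>.\<close>

lemma span_orbit_eq_UNIV:
  assumes "\<And>t. t \<in> V \<Longrightarrow> dot t w = 0 \<Longrightarrow> t = 0"
  shows "vec.span ((\<lambda>j. sg j w) ` {..<5}) = UNIV"
proof (rule ccontr)
  let ?S = "vec.span ((\<lambda>j. sg j w) ` {..<5})"
  assume "?S \<noteq> UNIV"
  then obtain p where "p \<notin> ?S" by blast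
  then obtain f where f: "\<forall>x\<in>?S. dot f x = 0" "dot f p = 1"
    using functional_separating[OF vec.subspace_span] by blast
  have "sg j w \<in> ?S" if "j < 5" for j using that by (intro vec.span_base) auto
  then have "dot f (sg j w) = 0" if "j < 5" for j using f that by blast
  from this[of 0] this[of 1] this[of 2] this[of 3] this[of 4]
  have "\<exists>t\<in>V. t \<noteq> 0 \<and> dot t w = 0"
    using f(2) by (intro rational_functional) auto
  then show False using assms by blast
qed

lemma rank_4_functional:
  fixes w :: "'a ^ 5"
  assumes "vec.dim ((\<lambda>j. sg j w) ` {..<5}) = 4"
  shows "\<exists>t\<in>V. t \<noteq> 0 \<and> dot t w = 0"
proof (rule ccontr)
  assume "\<not> ?thesis"
  then have "vec.span ((\<lambda>j. sg j w) ` {..<5}) = UNIV"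
    by (intro span_orbit_eq_UNIV) blast
  then have "vec.dim (UNIV :: ('a ^ 5) set) = 4" using assms vec.dim_span by metis
  then show False by (simp only: vec_dim_card) simp
qed

text \<open>The relation from \<open>trace_relation\<close> has only nonzero coefficients, so it
  expresses \<open>sg 4 w\<close> by the four earlier conjugates, which must then span dimension
  4.\<close>

lemma rank_4_lin_indep:
  fixes w :: "'a ^ 5"
  assumes "vec.dim ((\<lambda>j. sg j w) ` {..<5}) = 4"
  shows "lin_indep 4 (\<lambda>j. sg j w)"
proof -
  obtain t where "t \<in> V" "t \<noteq> 0" "dot t w = 0" using rank_4_functional[OF assms] by blast
  then obtain m where m: "m \<noteq> 0" "TV (m *s w) = 0" using trace_relation by blast
  let ?S = "vec.span ((\<lambda>j. sg j w) ` {..<4})"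
  have S: "sg j w \<in> ?S" if "j < 4" for j using that by (intro vec.span_base) auto
  have "fr 4 m *s sg 4 w = - (m *s sg 0 w + fr 1 m *s sg 1 w + fr 2 m *s sg 2 w + fr 3 m *s sg 3 w)"
    using m(2) unfolding eq_neg_iff_add_eq_0 by (simp add: TV_def add_ac)
  then have "sg 4 w = inverse (fr 4 m) *s - (m *s sg 0 w + fr 1 m *s sg 1 w + fr 2 m *s sg 2 w + fr 3 m *s sg 3 w)"
    using m(1) by (simp add: vec_eq_iff field_simps)
  also have "\<dots> \<in> ?S"
    by (intro vec.span_scale vec.span_neg vec.span_add S) auto
  finally have "sg 4 w \<in> ?S" .
  moreover have "{..<5::nat} = insert 4 {..<4}" by auto
  then have "(\<lambda>j. sg j w) ` {..<5} = insert (sg 4 w) ((\<lambda>j. sg j w) ` {..<4})"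
    by (simp only: image_insert)
  ultimately have "vec.dim ((\<lambda>j. sg j w) ` {..<4}) = 4"
    using assms by (simp add: vec.dim_insert)
  then show ?thesis by (rule lin_indep_if_dim)
qed

text \<open>Injectivity suffices, because \<open>V\<close> and the field both have
  \<open>q ^ 5\<close> elements.\<close>

lemma bij_betw_dot_V:
  fixes f :: "'a ^ 5"
  assumes "\<And>v. v \<in> V \<Longrightarrow> dot f v = 0 \<Longrightarrow> v = 0"
  shows "bij_betw (dot f) V UNIV"
proof -
  have inj: "inj_on (dot f) V"
  proof (rule inj_onI)
    fix x y assume "x \<in> V" "y \<in> V" "dot f x = dot f y"
    then have "x - y = 0" using V_closed by (intro assms) auto
    then show "x = y" by simp
  qed
  then have "card (dot f ` V) = card (UNIV :: 'a set)" by (simp add: card_image card_V card_K)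
  then have "dot f ` V = UNIV" by (intro card_subset_eq) auto
  then show ?thesis using inj by (simp add: bij_betw_def)
qed

lemma lin_indep_orbit_scale:
  assumes "lin_indep n (\<lambda>j. sg j w)" "c \<noteq> 0"
  shows "lin_indep n (\<lambda>j. sg j (c *s w))"
  using lin_indep_scale[OF assms(1), of "\<lambda>j. fr j c"] assms(2) by simp

lemma orbit_pair_independent:
  assumes "lin_indep 4 (\<lambda>j. sg j w)" "i < 4" "j < 4" "i \<noteq> j" "c *s sg i w + d *s sg j w = 0"
  shows "c = 0 \<and> d = 0"
proof -
  let ?c = "\<lambda>l. if l = i then c else if l = j then d else 0"
  have "(\<Sum>l<4. ?c l *s sg l w) = (\<Sum>l\<in>{i, j}. ?c l *s sg l w)"
    using assms by (intro sum.mono_neutral_right) auto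
  also have "\<dots> = 0" using assms by simp
  finally have "\<forall>l<4. ?c l = 0" using assms(1)[unfolded lin_indep_def, rule_format, of ?c] by simp
  from this[rule_format, of i] this[rule_format, of j] show ?thesis using assms by auto
qed

text \<open>The four conjugates of \<open>a\<close> lie in the hyperplane of \<open>t\<close>, which
  is over \<open>F\<close>, and \<open>b\<close> does not; together they form a basis.\<close>

lemma orbit_and_vector_prescribed:
  assumes a4: "lin_indep 4 (\<lambda>j. sg j a)" and t: "t \<in> V" "dot t a = 0" "dot t b \<noteq> 0"
  shows "\<exists>f. dot f a = r0 \<and> dot f (sg 1 a) = r1 \<and> dot f (sg 2 a) = r2 \<and> dot f (sg 3 a) = r3 \<and> dot f b = s"
proof -
  define w where "w j = (if j = 4 then b else sg j a)" for j :: nat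
  define r where "r j = (if j = 0 then r0 else if j = 1 then r1 else if j = 2 then r2
    else if j = 3 then r3 else s)" for j :: nat
  have "lin_indep 4 w"
    using a4 unfolding lin_indep_def w_def by simp
  then have "lin_indep (Suc 4) w"
    by (rule lin_indep_Suc[where t = t]) (use t in \<open>auto simp: w_def dot_V_sg\<close>)
  then obtain f where f: "\<And>i. i < Suc 4 \<Longrightarrow> dot f (w i) = r i"
    using functional_prescribed[of "Suc 4" w r] by blast
  from f[of 0] f[of 1] f[of 2] f[of 3] f[of 4] show ?thesis
    by (auto simp: w_def r_def)
qed

text \<open>Subtracting \<open>dot t v *s c\<close> moves \<open>v\<close> into the span of the
  orbit of \<open>b\<close> without leaving \<open>V\<close>, and there every vector of
  \<open>V\<close> is a trace.\<close>

lemma orbit_complement_decomposition: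
  fixes b c v :: "'a ^ 5"
  assumes b4: "lin_indep 4 (\<lambda>j. sg j b)" and t: "t \<in> V" "dot t b = 0" "dot t c = 1"
    and "c \<in> V" "v \<in> V"
  shows "\<exists>x. v = TV (x *s b) + dot t v *s c"
proof -
  define w where "w j = (if j = 4 then c else sg j b)" for j :: nat
  have "lin_indep 4 w" using b4 unfolding lin_indep_def w_def by simp
  then have "lin_indep (Suc 4) w"
    by (rule lin_indep_Suc[where t = t]) (use t in \<open>auto simp: w_def dot_V_sg\<close>)
  then have "lin_indep 5 w" by simp
  from lin_indep_spans[OF this vec.subspace_UNIV, of v]
  obtain y where "v = (\<Sum>j<5. y j *s w j)" by (auto simp: card_cart_basis)
  then have v: "v = y 0 *s b + y 1 *s sg 1 b + y 2 *s sg 2 b + y 3 *s sg 3 b + y 4 *s c"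
    by (simp add: sum_lessThan_5 w_def)
  have "dot t v = y 4" unfolding v using t by (simp add: dot_V_sg)
  \<comment> \<open>The fifth conjugate gets coefficient 0, to match the form that
    \<open>rational_combination_eq_TV\<close> expects.\<close>
  then have *: "v - dot t v *s c = (\<Sum>j<5. (if j = 4 then 0 else y j) *s sg j b)"
    by (simp add: sum_lessThan_5) (subst v, simp)
  have "v - dot t v *s c \<in> V" using assms by (intro V_closed dot_V_F) auto
  from rational_combination_eq_TV[OF this *]
  obtain x where "v - dot t v *s c = TV (x *s b)" by blast
  then show ?thesis by (auto simp: algebra_simps)
qed

text \<open>Comparing \<open>z + fr 2 z\<close> with its image under \<open>fr 2\<close> leaves
  \<open>fr 4 z = z\<close>.\<close>

lemma fr_2_add_self_in_F:
  assumes "z + fr 2 z \<in> F"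
  shows "z \<in> F"
proof -
  have "fr 2 (z + fr 2 z) = z + fr 2 z" using assms by (rule fr_F)
  then have "fr 4 z = z" by simp
  then show ?thesis using fr_fixed_imp_F by blast
qed

text \<open>If \<open>T\<close> vanished at every \<open>s\<close> with
  \<open>T (s * m) = - 1\<close>, it would vanish on the differences of such elements too, and so
  everywhere.\<close>

lemma ex_trace_pair:
  assumes "m \<noteq> 0"
  shows "\<exists>s. T (s * m) = - 1 \<and> T s \<noteq> 0"
proof (rule ccontr)
  assume neg: "\<not> ?thesis"
  obtain t where t: "T t = 1" using ex_T_eq_1 by blast
  define s where "s = - (t / m)"
  have s: "T (s * m) = - 1" using assms t by (simp add: s_def)
  then have s0: "T s = 0" using neg by blast
  have "T (1 * y) = 0" for y
  proof -
    \<comment> \<open>The multiple of \<open>s\<close> is chosen so that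
      \<open>T (x * m) = 0\<close>; hence \<open>s + x\<close> satisfies the same condition as
      \<open>s\<close>.\<close>
    define x where "x = y + T (y * m) * s"
    have "T (x * m) = T (y * m) + T (T (y * m) * (s * m))" by (simp add: x_def algebra_simps)
    also have "\<dots> = 0" by (simp add: T_scale s)
    finally have "T ((s + x) * m) = - 1" by (simp add: s distrib_right)
    then have "T x = 0" using neg s0 by auto
    then show ?thesis by (simp add: x_def T_scale s0)
  qed
  then have "(1::'a) = 0" by (rule T_nondegenerate)
  then show False by simp
qed

text \<open>By symmetry of \<open>dot\<close>, no hyperplane over \<open>F\<close> contains
  \<open>f\<close>. So the conjugates of \<open>f\<close> are a basis of the space of forms, in
  which the forms over \<open>F\<close> are traces.\<close>

lemma bij_functional_represents:
  fixes f :: "'a ^ 5"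
  assumes "\<And>v. v \<in> V \<Longrightarrow> dot f v = 0 \<Longrightarrow> v = 0" "t \<in> V"
  shows "\<exists>x. t = TV (x *s f)"
proof -
  have "vec.span ((\<lambda>j. sg j f) ` {..<5}) = UNIV"
    using assms(1) by (intro span_orbit_eq_UNIV) (simp add: dot_commute)
  then have "vec.dim ((\<lambda>j. sg j f) ` {..<5}) = 5"
    using vec.dim_span[of "(\<lambda>j. sg j f) ` {..<5}"] by (simp add: card_cart_basis)
  then have "lin_indep 5 (\<lambda>j. sg j f)" by (rule lin_indep_if_dim)
  from lin_indep_spans[OF this vec.subspace_UNIV, of t]
  obtain c where "t = (\<Sum>j<5. c j *s sg j f)" by (auto simp: card_cart_basis)
  then show ?thesis by (rule rational_combination_eq_TV[OF assms(2)])
qed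

end

subsection \<open>Planes disjoint from the subgeometry\<close>

text \<open>Coordinates are chosen such that the points of the subgeometry come from
  \<open>V\<close>. Then \<open>G_V\<close> is the disjointness from it, while
  \<open>G_rational\<close> is what maximum scatteredness will supply.\<close>

locale external_plane = quintic_field q K
  for q and K :: "'a::{field,finite} itself" +
  fixes G :: "('a ^ 5) set"
  assumes subspace_G: "vec.subspace G" and dim_G: "vec.dim G = 3"
    and G_V: "\<And>v. v \<in> G \<Longrightarrow> v \<in> V \<Longrightarrow> v = 0"
    and G_rational: "\<And>t. t \<in> V \<Longrightarrow> t \<noteq> 0 \<Longrightarrow> \<exists>x\<in>G. dot t x \<noteq> 0"
begin

text \<open>The witnesses \<open>p\<close> and \<open>r\<close> encode the linear independence of
  the two forms, in the shape required by \<open>common_kernel_eq\<close>.\<close>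

definition equations :: "'a ^ 5 \<Rightarrow> 'a ^ 5 \<Rightarrow> bool" where
  "equations f g \<longleftrightarrow> (\<forall>x\<in>G. dot f x = 0 \<and> dot g x = 0) \<and>
    (\<exists>p r. dot f p \<noteq> 0 \<and> dot g p = 0 \<and> dot g r \<noteq> 0)"

lemma G_iff: "equations f g \<Longrightarrow> x \<in> G \<longleftrightarrow> dot f x = 0 \<and> dot g x = 0"
  unfolding equations_def using common_kernel_eq[OF subspace_G dim_G] by blast

lemma three_in_G_span:
  assumes "lin_indep 3 w" "w 0 \<in> G" "w 1 \<in> G" "w 2 \<in> G" "x \<in> G"
  shows "\<exists>c0 c1 c2. x = c0 *s w 0 + c1 *s w 1 + c2 *s w 2"
proof -
  have "w i \<in> G" if "i < 3" for i
  proof -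
    from that have "i = 0 \<or> i = 1 \<or> i = 2" by linarith
    then show ?thesis using assms(2-4) by blast
  qed
  then obtain c where "x = (\<Sum>i<3. c i *s w i)"
    using lin_indep_spans[OF assms(1) subspace_G] dim_G assms(5) by auto
  then show ?thesis by (auto simp: sum_lessThan_3)
qed

lemma equationsI:
  assumes "lin_indep 3 w" "w 0 \<in> G" "w 1 \<in> G" "w 2 \<in> G"
    and "dot f (w 0) = 0" "dot f (w 1) = 0" "dot f (w 2) = 0"
    and "dot g (w 0) = 0" "dot g (w 1) = 0" "dot g (w 2) = 0"
    and "dot f p \<noteq> 0" "dot g p = 0" "dot g r \<noteq> 0"
  shows "equations f g"
proof -
  have "dot f x = 0 \<and> dot g x = 0" if "x \<in> G" for x
  proof -
    obtain c0 c1 c2 where "x = c0 *s w 0 + c1 *s w 1 + c2 *s w 2"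
      using three_in_G_span[OF assms(1-4) \<open>x \<in> G\<close>] by blast
    then show ?thesis using assms(5-10) by simp
  qed
  then show ?thesis unfolding equations_def using assms(11-13) by blast
qed

text \<open>A power of \<open>sg s\<close> is \<open>sg 1\<close>: the second for
  \<open>s = 3\<close>, the fourth for \<open>s = 4\<close>. So a nonzero \<open>S\<close> would
  meet \<open>V\<close>.\<close>

lemma no_invariant_subspace:
  assumes "vec.subspace S" "S \<subseteq> G" "\<And>x. x \<in> S \<Longrightarrow> sg s x \<in> S" "s \<in> {3, 4}" "w \<in> S"
  shows "w = 0"
proof (rule ccontr)
  assume "w \<noteq> 0"
  have "sg 1 x \<in> S" if "x \<in> S" for x
  proof -
    have "sg s (sg s x) \<in> S" "sg s (sg s (sg s (sg s x))) \<in> S" using assms(3) that by blast+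
    then show ?thesis using assms(4) by auto
  qed
  then have "\<exists>v\<in>S \<inter> V. v \<noteq> 0"
    using invariant_subspace_meets_V[OF assms(1) _ assms(5) \<open>w \<noteq> 0\<close>] by blast
  then show False using assms(2) G_V by blast
qed

text \<open>The intersection of \<open>G\<close> with its conjugate, and the conjugate of this
  intersection, are both at least two-dimensional inside the conjugate of \<open>G\<close>, so they
  meet. Unwinding a common vector gives \<open>p\<close> such that \<open>p\<close> and its first
  two images under \<open>sg s\<close> lie in \<open>G\<close>.\<close>

lemma pseudoregulus_equations:
  assumes s: "s \<in> {3, 4}" and dim: "vec.dim (G \<inter> sg s ` G) \<ge> 2"
  shows "\<exists>f. equations f (sg s f) \<and> bij_betw (dot f) V UNIV"
proof -
  let ?N = "G \<inter> sg s ` G"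
  have s5: "s \<le> 5" using s by auto
  have sub: "vec.subspace (sg s ` G)" "vec.subspace ?N" "vec.subspace (sg s ` ?N)"
    using subspace_G s5 by (auto intro: subspace_sg_image vec.subspace_inter)
  have "{x + y |x y. x \<in> ?N \<and> y \<in> sg s ` ?N} \<subseteq> sg s ` G"
    using vec.subspace_add[OF sub(1)] by auto
  from vec.dim_subset[OF this] have "vec.dim {x + y |x y. x \<in> ?N \<and> y \<in> sg s ` ?N} \<le> 3"
    using dim_sg_image[OF s5, of G] dim_G by simp
  moreover have "vec.dim {x + y |x y. x \<in> ?N \<and> y \<in> sg s ` ?N} + vec.dim (?N \<inter> sg s ` ?N)
      = vec.dim ?N + vec.dim (sg s ` ?N)"
    by (rule vec.dim_sums_Int) (use sub in auto)
  ultimately have "vec.dim (?N \<inter> sg s ` ?N) \<ge> 1"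
    using dim dim_sg_image[OF s5, of ?N] by simp
  then have "\<not> ?N \<inter> sg s ` ?N \<subseteq> {0}"
    using vec.dim_eq_0[of "?N \<inter> sg s ` ?N"] by linarith
  then obtain y z p where y: "y \<in> G" "y \<noteq> 0" "y = sg s z" "z \<in> G" "z = sg s p" and "p \<in> G"
    by blast
  then have p: "p \<in> G" "sg s p \<in> G" "sg s (sg s p) \<in> G" "p \<noteq> 0"
    by (simp_all only:) auto
  define w where "w i = (if i = 0 then p else if i = 1 then sg s p else sg s (sg s p))" for i :: nat
  have w: "w 0 = p" "w 1 = sg s p" "w 2 = sg s (sg s p)" by (simp_all add: w_def)
  have li: "lin_indep 3 w"
  proof (rule ccontr)
    assume "\<not> lin_indep 3 w"
    then obtain c :: "nat \<Rightarrow> 'a" and i where c: "(\<Sum>i<3. c i *s w i) = 0" "i < 3" "c i \<noteq> 0"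
      unfolding lin_indep_def by blast
    have i: "i = 0 \<or> i = 1 \<or> i = 2" using c(2) by linarith
    have eq: "c 0 *s p + c 1 *s sg s p + c 2 *s sg s (sg s p) = 0"
      using c(1) by (simp only: sum_lessThan_3 w)
    \<comment> \<open>The last nonzero coefficient decides: the vectors before it would span a
      subspace of \<open>G\<close> stable under \<open>sg s\<close>, and if there are none,
      \<open>p\<close> would be 0.\<close>
    consider "c 2 \<noteq> 0" | "c 2 = 0" "c 1 \<noteq> 0" | "c 2 = 0" "c 1 = 0" "c 0 \<noteq> 0"
      using i c(3) by auto
    then show False
    proof cases
      case 1
      let ?S = "vec.span {p, sg s p}"
      have "sg s (sg s p) = inverse (c 2) *s (c 2 *s sg s (sg s p))" using 1 by simp
      also have "c 2 *s sg s (sg s p) = - (c 0 *s p + c 1 *s sg s p)"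
        using eq unfolding eq_neg_iff_add_eq_0 by (simp only: add_ac)
      also have "inverse (c 2) *s \<dots> \<in> ?S"
        by (intro vec.span_scale vec.span_neg vec.span_add vec.span_base) auto
      finally have *: "sg s (sg s p) \<in> ?S" .
      have "sg s x \<in> ?S" if "x \<in> ?S" for x
        using that
      proof (induction rule: vec.span_induct_alt)
        case (step c x y)
        have "sg s x \<in> ?S" using step(1) * by (auto intro: vec.span_base)
        then show ?case using step by (auto intro: vec.span_add vec.span_scale)
      qed (simp add: vec.span_zero)
      moreover have "?S \<subseteq> G" using p subspace_G by (intro vec.span_minimal) auto
      moreover have "p \<in> ?S" by (intro vec.span_base) auto
      ultimately show False using no_invariant_subspace[OF vec.subspace_span _ _ s] p(4) by blast
    next
      case 2
      let ?S = "vec.span {p}"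
      have "sg s p = inverse (c 1) *s (c 1 *s sg s p)" using 2 by simp
      also have "c 1 *s sg s p = - (c 0 *s p)"
        using eq 2 by (simp add: eq_neg_iff_add_eq_0 add.commute)
      also have "inverse (c 1) *s \<dots> \<in> ?S"
        by (intro vec.span_scale vec.span_neg vec.span_base) auto
      finally have *: "sg s p \<in> ?S" .
      have "sg s x \<in> ?S" if "x \<in> ?S" for x
        using that
      proof (induction rule: vec.span_induct_alt)
        case (step c x y)
        have "sg s x \<in> ?S" using step(1) * by auto
        then show ?case using step by (auto intro: vec.span_add vec.span_scale)
      qed (simp add: vec.span_zero)
      moreover have "?S \<subseteq> G" using p subspace_G by (intro vec.span_minimal) auto
      moreover have "p \<in> ?S" by (intro vec.span_base) auto
      ultimately show False using no_invariant_subspace[OF vec.subspace_span _ _ s] p(4) by blast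
    next
      case 3
      then show False using eq p(4) by simp
    qed
  qed
  have wG: "w 0 \<in> G" "w 1 \<in> G" "w 2 \<in> G" using p by (simp_all only: w)
  \<comment> \<open>A hyperplane over \<open>F\<close> through \<open>p\<close> contains all
    conjugates of \<open>p\<close> and hence \<open>G\<close>, against
    \<open>G_rational\<close>.\<close>
  have "t = 0" if t: "t \<in> V" "dot t p = 0" for t
  proof (rule ccontr)
    assume "t \<noteq> 0"
    then obtain x where x: "x \<in> G" "dot t x \<noteq> 0" using G_rational t by blast
    obtain c0 c1 c2 where "x = c0 *s w 0 + c1 *s w 1 + c2 *s w 2"
      using three_in_G_span[OF li wG x(1)] by blast
    then have "dot t x = 0" using t by (simp add: w[unfolded One_nat_def] dot_V_sg)
    then show False using x(2) by simp
  qed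
  then have "vec.span ((\<lambda>j. sg j p) ` {..<5}) = UNIV" by (rule span_orbit_eq_UNIV)
  then have "vec.dim ((\<lambda>j. sg j p) ` {..<5}) = 5"
    using vec.dim_span[of "(\<lambda>j. sg j p) ` {..<5}"] by (simp add: card_cart_basis)
  then have "lin_indep 5 (\<lambda>j. sg j p)" by (rule lin_indep_if_dim)
  \<comment> \<open>On the orbit of \<open>p\<close>, \<open>f\<close> is nonzero only at
    \<open>sg (3 * s) p\<close>, so \<open>sg s f\<close> is nonzero only at
    \<open>sg (4 * s) p\<close>; both vanish on the basis \<open>w\<close> of
    \<open>G\<close>.\<close>
  from functional_prescribed[OF this, of "\<lambda>j. if j = (3 * s) mod 5 then 1 else 0"]
  obtain f where f: "\<And>j. j < 5 \<Longrightarrow> dot f (sg j p) = (if j = (3 * s) mod 5 then 1 else 0)" by blast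
  note f' = f[of 0] f[of 1] f[of 2] f[of 3] f[of 4]
  have "equations f (sg s f)"
  proof (rule equationsI[OF li wG])
    show "dot f (w 0) = 0" "dot f (w 1) = 0" "dot f (w 2) = 0"
      "dot (sg s f) (w 0) = 0" "dot (sg s f) (w 1) = 0" "dot (sg s f) (w 2) = 0"
      using s f' unfolding w by (auto simp: dot_sg_left)
    show "dot f (sg (3 * s) p) \<noteq> 0" "dot (sg s f) (sg (3 * s) p) = 0" "dot (sg s f) (sg (4 * s) p) \<noteq> 0"
      using s f' by (auto simp: dot_sg_left)
  qed
  moreover have "v = 0" if "v \<in> V" "dot f v = 0" for v
  proof -
    have "v \<in> G" using that G_iff[OF calculation] by (simp add: dot_sg_V)
    then show ?thesis using that G_V by blast
  qed
  ultimately show ?thesis using bij_betw_dot_V by blast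
qed

text \<open>As \<open>z\<close> is outside the hyperplane of \<open>t\<close>, this hyperplane cuts
  \<open>G\<close> in a two-dimensional space, with basis \<open>x\<close>,
  \<open>y\<close>.\<close>

lemma span_in_G:
  assumes "\<And>c d. c *s x + d *s y = 0 \<Longrightarrow> c = 0 \<and> d = 0" "x \<in> G" "y \<in> G" "z \<in> G"
    and "dot t x = 0" "dot t y = 0" "dot t z \<noteq> 0" "u \<in> G" "dot t u = 0"
  shows "\<exists>c d. u = c *s x + d *s y"
proof -
  obtain c d e where "u = c *s x + d *s y + e *s z"
    using three_in_G_span[OF lin_indep_triple[OF assms(1,5-7)], where x = u] assms(2-4,8) by auto
  moreover from this have "e = 0" using assms(5-7,9) by simp
  ultimately show ?thesis by auto
qed

text \<open>Otherwise \<open>b\<close> and \<open>sg 2 b\<close> would both be combinations of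
  \<open>a\<close> and \<open>sg 1 a\<close>. But the former makes \<open>sg 2 b\<close> a
  combination of \<open>sg 2 a\<close> and \<open>sg 3 a\<close>, against the independence of the
  four conjugates.\<close>

lemma no_common_rational_hyperplane:
  assumes "a \<in> G" "sg 1 a \<in> G" "b \<in> G" "sg 2 b \<in> G" "b \<noteq> 0"
    and a4: "lin_indep 4 (\<lambda>j. sg j a)"
    and t: "t \<in> V" "t \<noteq> 0" "dot t a = 0"
  shows "dot t b \<noteq> 0"
proof
  assume tb: "dot t b = 0"
  obtain g where g: "g \<in> G" "dot t g \<noteq> 0" using G_rational t by blast
  have ind: "c = 0 \<and> d = 0" if "c *s a + d *s sg 1 a = 0" for c d
    using orbit_pair_independent[OF a4, of 0 1 c d] that by simp
  have sp: "\<exists>c d. u = c *s a + d *s sg 1 a" if "u \<in> G" "dot t u = 0" for u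
    by (rule span_in_G[OF ind, where z = g and t = t]) (use assms g that in \<open>auto simp: dot_V_sg\<close>)
  obtain c d where cd: "b = c *s a + d *s sg 1 a" using sp assms(3) tb by blast
  obtain c' d' where cd': "sg 2 b = c' *s a + d' *s sg 1 a"
    using sp[OF assms(4)] tb t by (auto simp: dot_V_sg)
  have "sg 2 b = fr 2 c *s sg 2 a + fr 2 d *s sg 3 a" by (subst cd) simp
  then have "c' *s sg 0 a + d' *s sg 1 a + (- fr 2 c) *s sg 2 a + (- fr 2 d) *s sg 3 a = 0"
    using cd' by (simp add: vec.scale_minus_left algebra_simps)
  from lin_indep_4D[OF a4 this] have "c = 0 \<and> d = 0" by simp
  then show False using cd assms(5) by simp
qed

text \<open>\<open>tc\<close> and \<open>td\<close> are hyperplanes over \<open>F\<close> through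
  \<open>a\<close> and \<open>b\<close>. After scaling, both kill \<open>sg 2 b - b\<close>:
  \<open>tc\<close> makes it a combination of \<open>a\<close> and \<open>sg 1 a\<close>, and
  \<open>td\<close> makes the two coefficients opposite.\<close>

lemma normal_form:
  assumes G: "a0 \<in> G" "sg 1 a0 \<in> G" "b0 \<in> G" "sg 2 b0 \<in> G"
    and dims: "vec.dim ((\<lambda>j. sg j a0) ` {..<5}) = 4" "vec.dim ((\<lambda>j. sg j b0) ` {..<5}) = 4"
  obtains a b tc td y where "a \<in> G" "sg 1 a \<in> G" "b \<in> G" "sg 2 b \<in> G"
    "lin_indep 4 (\<lambda>j. sg j a)" "lin_indep 4 (\<lambda>j. sg j b)"
    "tc \<in> V" "td \<in> V" "dot tc a = 0" "dot tc b = 1" "dot td a = 1" "dot td b = 0"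
    "y \<noteq> 0" "sg 2 b - b = y *s (sg 1 a - a)"
proof -
  have a4: "lin_indep 4 (\<lambda>j. sg j a0)" and b4: "lin_indep 4 (\<lambda>j. sg j b0)"
    using dims by (auto intro: rank_4_lin_indep)
  have "b0 \<noteq> 0"
    using orbit_pair_independent[OF b4, of 0 1 1 0] by auto
  obtain tc where tc: "tc \<in> V" "tc \<noteq> 0" "dot tc a0 = 0" using rank_4_functional[OF dims(1)] by blast
  obtain td where td: "td \<in> V" "td \<noteq> 0" "dot td b0 = 0" using rank_4_functional[OF dims(2)] by blast
  have tcb: "dot tc b0 \<noteq> 0"
    using no_common_rational_hyperplane[OF G \<open>b0 \<noteq> 0\<close> a4 tc] .
  have tda: "dot td a0 \<noteq> 0"
    using no_common_rational_hyperplane[OF G \<open>b0 \<noteq> 0\<close> a4 td(1,2)] td(3) by blast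
  define a where "a = inverse (dot td a0) *s a0"
  define b where "b = inverse (dot tc b0) *s b0"
  have aG: "a \<in> G" "sg 1 a \<in> G" and bG: "b \<in> G" "sg 2 b \<in> G"
    using G subspace_G by (auto simp: a_def b_def vec.subspace_scale)
  have a4': "lin_indep 4 (\<lambda>j. sg j a)"
    unfolding a_def by (rule lin_indep_orbit_scale[OF a4]) (use tda in simp)
  have b4': "lin_indep 4 (\<lambda>j. sg j b)"
    unfolding b_def by (rule lin_indep_orbit_scale[OF b4]) (use tcb in simp)
  have dots: "dot tc a = 0" "dot tc b = 1" "dot td a = 1" "dot td b = 0"
    using tc td tcb tda by (auto simp: a_def b_def)
  have ind: "c = 0 \<and> d = 0" if "c *s a + d *s sg 1 a = 0" for c d
    using orbit_pair_independent[OF a4', of 0 1 c d] that by simp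
  have "\<exists>c d. sg 2 b - b = c *s a + d *s sg 1 a"
    by (rule span_in_G[OF ind, where z = b and t = tc])
      (use aG bG dots tc subspace_G in \<open>auto simp: dot_V_sg vec.subspace_diff\<close>)
  then obtain c d where cd: "sg 2 b - b = c *s a + d *s sg 1 a" by blast
  have "dot td (sg 2 b - b) = 0" using dots td by (simp add: dot_V_sg)
  then have "c + d = 0" unfolding cd using dots td by (simp add: dot_V_sg)
  then have c: "c = - d" by (simp add: eq_neg_iff_add_eq_0)
  have eq: "sg 2 b - b = d *s (sg 1 a - a)"
    unfolding cd c by (simp add: vec_eq_iff algebra_simps)
  have "d \<noteq> 0"
  proof
    assume "d = 0"
    then have "1 *s sg 2 b + (- 1) *s sg 0 b = 0" using eq by simp
    from orbit_pair_independent[OF b4' _ _ _ this] show False by simp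
  qed
  from that[OF aG bG a4' b4' tc(1) td(1) dots this eq] show thesis .
qed

text \<open>The form \<open>f\<close> is chosen so that the first equation holds at \<open>a\<close>
  and \<open>sg 1 a\<close> for every \<open>k\<close>; its validity at \<open>b\<close> leads to
  \<open>k = fr 2 y / fr 3 y\<close>. Being a quotient of conjugates, \<open>k\<close> has norm 1,
  and \<open>y \<notin> F\<close> gives \<open>k \<noteq> 1\<close>, which makes the two forms
  independent.\<close>

lemma LF_equations:
  assumes "a \<in> G" "sg 1 a \<in> G" "b \<in> G"
    and a4: "lin_indep 4 (\<lambda>j. sg j a)"
    and tc: "tc \<in> V" "dot tc a = 0" "dot tc b = 1"
    and y: "y \<notin> F" and ab: "sg 2 b - b = y *s (sg 1 a - a)"
  shows "\<exists>k f. Nm q k = 1 \<and> bij_betw (dot f) V UNIV \<and>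
    equations (k *s (sg 1 f + sg 3 f) + sg 2 f + sg 4 f) f"
proof -
  have "y \<noteq> 0" using y F_closed(1) by metis
  \<comment> \<open>The conjugates of \<open>u\<close> are the inverses of the coefficients in the
    relation \<open>rel\<close> between the conjugates of \<open>a\<close>.\<close>
  define u where "u = inverse (y - fr 4 y)"
  have "y \<noteq> fr 4 y" using y fr_fixed_imp_F[of 4 y] by auto
  then have u0: "u \<noteq> 0" and uy: "u * (y - fr 4 y) = 1" by (simp_all add: u_def)
  have uy1: "fr 1 u * (fr 1 y - y) = 1" and uy2: "fr 2 u * (fr 2 y - fr 1 y) = 1"
    and uy3: "fr 3 u * (fr 3 y - fr 2 y) = 1" and uy4: "fr 4 u * (fr 4 y - fr 3 y) = 1"
    using arg_cong[OF uy, of "fr 1"] arg_cong[OF uy, of "fr 2"] arg_cong[OF uy, of "fr 3"]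
      arg_cong[OF uy, of "fr 4"] by simp_all
  have rel: "(y - fr 4 y) *s a + (fr 1 y - y) *s sg 1 a + (fr 2 y - fr 1 y) *s sg 2 a +
      (fr 3 y - fr 2 y) *s sg 3 a + (fr 4 y - fr 3 y) *s sg 4 a = 0"
  proof -
    \<comment> \<open>Taking the trace of \<open>ab\<close> eliminates \<open>b\<close> and leaves a
      relation for \<open>a\<close> alone.\<close>
    have "TV (sg 2 b - b) = 0" by simp
    then have "TV (y *s (sg 1 a - a)) = 0" unfolding ab .
    then show ?thesis by (simp add: TV_def vec_eq_iff algebra_simps)
  qed
  \<comment> \<open>Repeated application of \<open>sg 2\<close> reaches the conjugates of
    \<open>b\<close> in the order 2, 4, 1, 3.\<close>
  have b2: "sg 2 b = b + y *s (sg 1 a - a)"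
    using ab by (simp add: algebra_simps)
  have b4: "sg 4 b = sg 2 b + fr 2 y *s (sg 3 a - sg 2 a)"
    using arg_cong[OF b2, of "sg 2"] by simp
  have b1: "sg 1 b = sg 4 b + fr 4 y *s (a - sg 4 a)"
    using arg_cong[OF b2, of "sg 4"] by simp
  have b3: "sg 3 b = sg 1 b + fr 1 y *s (sg 2 a - sg 1 a)"
    using arg_cong[OF b2, of "sg 1"] by simp
  \<comment> \<open>in the coordinates \<open>f, sg 1 f, \<dots>, sg 4 f\<close>, the vector \<open>a\<close> becomes \<open>(0, u, 0, - u, 0)\<close>\<close>
  obtain f where f: "dot f a = 0" "dot f (sg 1 a) = 0" "dot f (sg 2 a) = - fr 2 u"
    "dot f (sg 3 a) = 0" "dot f b = 0"
    using orbit_and_vector_prescribed[OF a4 tc(1,2), of b 0 0 "- fr 2 u" 0 0] tc(3) by auto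
  \<comment> \<open>The value at the fifth conjugate is not free: it is forced by
    \<open>rel\<close>.\<close>
  have f4: "dot f (sg 4 a) = fr 4 u"
  proof -
    have "dot f ((y - fr 4 y) *s a + (fr 1 y - y) *s sg 1 a + (fr 2 y - fr 1 y) *s sg 2 a +
      (fr 3 y - fr 2 y) *s sg 3 a + (fr 4 y - fr 3 y) *s sg 4 a) = 0" unfolding rel by simp
    then have "(fr 4 y - fr 3 y) * dot f (sg 4 a) = fr 2 u * (fr 2 y - fr 1 y)"
      using f by (simp add: algebra_simps)
    also have "\<dots> = (fr 4 y - fr 3 y) * fr 4 u" using uy2 uy4 by (simp add: mult.commute)
    finally show ?thesis using uy4 by (auto simp: mult_cancel_left)
  qed
  define k where "k = fr 2 y / fr 3 y"
  have k: "k * fr 3 y = fr 2 y" using \<open>y \<noteq> 0\<close> by (simp add: k_def)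
  have "k \<noteq> 1" using k uy3 by auto
  let ?g = "k *s (sg 1 f + sg 3 f) + sg 2 f + sg 4 f"
  have fb: "dot f (sg 2 b) = 0" "dot f (sg 4 b) = fr 2 y * fr 2 u"
    "dot f (sg 1 b) = fr 2 y * fr 2 u - fr 4 y * fr 4 u"
    "dot f (sg 3 b) = fr 2 y * fr 2 u - fr 4 y * fr 4 u - fr 1 y * fr 2 u"
    using f f4 by (simp_all add: b2 b4 b1[unfolded One_nat_def] b3[unfolded One_nat_def])
  have fb3: "dot f (sg 3 b) = - (fr 3 y * fr 4 u)"
    using uy2 uy4 unfolding fb(4) by (simp add: algebra_simps)
  have li: "lin_indep 3 (\<lambda>i::nat. if i = 0 then a else if i = 1 then sg 1 a else b)"
    by (rule lin_indep_triple[where t = tc])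
      (use orbit_pair_independent[OF a4, of 0 1] tc in \<open>auto simp: dot_V_sg\<close>)
  have gb: "dot ?g b = 0"
  proof -
    have "dot ?g b = k * (fr 3 y * fr 3 u) + (fr 1 y * fr 1 u - fr 3 y * fr 3 u - y * fr 1 u)"
      by (simp add: dot_sg_left[unfolded One_nat_def] fb(1-3)[unfolded One_nat_def] fb3)
    also have "\<dots> = (k * fr 3 y - fr 2 y) * fr 3 u + fr 1 u * (fr 1 y - y) - fr 3 u * (fr 3 y - fr 2 y)"
      by (simp add: algebra_simps)
    also have "\<dots> = 0" unfolding k uy1 uy3 by simp
    finally show ?thesis .
  qed
  have eqs: "equations ?g f"
  proof (rule equationsI[OF li])
    show "dot ?g (sg 3 a) \<noteq> 0"
    proof -
      have "dot ?g (sg 3 a) = (1 - k) * fr 3 u"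
        using f f4 by (simp add: dot_sg_left[unfolded One_nat_def] algebra_simps)
      then show ?thesis using \<open>k \<noteq> 1\<close> u0 by simp
    qed
    show "dot f (sg 2 a) \<noteq> 0" using f u0 by simp
  qed (use assms f f4 gb in \<open>auto simp: dot_sg_left[unfolded One_nat_def]\<close>)
  \<comment> \<open>On \<open>V\<close> the conjugates of \<open>f\<close> take the conjugates of
    the value of \<open>f\<close>, so one zero of \<open>f\<close> in \<open>V\<close> satisfies
    both equations.\<close>
  have "v = 0" if "v \<in> V" "dot f v = 0" for v
  proof -
    have "v \<in> G" using that G_iff[OF eqs] by (simp add: dot_sg_V)
    then show ?thesis using that G_V by blast
  qed
  then have "bij_betw (dot f) V UNIV" by (rule bij_betw_dot_V)
  moreover have "Nm q k = 1"
  proof -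
    have "Nm q k = k * fr 1 k * fr 2 k * fr 3 k * fr 4 k"
      by (simp add: Nm_def fr_def power_add)
    also have "\<dots> = 1" using \<open>y \<noteq> 0\<close> by (simp add: k_def)
    finally show ?thesis .
  qed
  ultimately show ?thesis using eqs by blast
qed

text \<open>The scalar \<open>y\<close> is normalised to 1 here. This makes
  \<open>a - b - sg 1 b\<close> a vector of \<open>V\<close>, so that everything is expressed by
  \<open>b\<close> and its trace relation.\<close>

lemma E_equations:
  assumes G: "a \<in> G" "b \<in> G" "sg 2 b \<in> G"
    and b4: "lin_indep 4 (\<lambda>j. sg j b)"
    and tc: "tc \<in> V" "dot tc a = 0" "dot tc b = 1"
    and td: "td \<in> V" "dot td a = 1" "dot td b = 0"
    and ab: "sg 2 b - b = sg 1 a - a"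
  shows "\<exists>\<eta> \<rho> f. \<eta> \<noteq> 0 \<and> T \<eta> = 0 \<and> T \<rho> \<noteq> 0 \<and> bij_betw (dot f) V UNIV \<and>
    equations (sg 1 f - sg 4 f) (\<eta> *s (sg 1 f - f) + TV (\<rho> *s f))"
proof -
  define v0 where "v0 = a - b - sg 1 b"
  have a: "a = b + sg 1 b + v0" by (simp add: v0_def)
  have v0: "v0 \<in> V"
    using ab by (simp add: V_iff v0_def algebra_simps)
  have tdv0: "dot td v0 = 1" using td by (simp add: v0_def dot_V_sg)
  have "td \<noteq> 0" using td by auto
  then obtain m where m: "m \<noteq> 0" "TV (m *s b) = 0" using trace_relation td by blast
  have Tm: "T m = 0"
    using arg_cong[OF m(2), of "dot tc"] tc by (simp add: dot_V_TV)
  define \<eta> where "\<eta> = m + fr 2 m"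
  have \<eta>: "\<eta> \<noteq> 0"
  \<comment> \<open>If \<open>\<eta> = 0\<close>, then \<open>m\<close> lies in \<open>F\<close>,
    hence \<open>m + m = 0\<close>; together with five times \<open>m\<close> being
    \<open>T m = 0\<close> this gives \<open>m = 0\<close>, in every characteristic.\<close>
  proof
    assume "\<eta> = 0"
    then have m2: "m + fr 2 m = 0" by (simp add: \<eta>_def)
    have mF: "m \<in> F" by (rule fr_2_add_self_in_F) (simp add: m2)
    have mm: "m + m = 0" using m2 by (simp add: fr_F[OF mF])
    have "m + m + m + m + m = 0" using Tm by (simp add: T_eq fr_F[OF mF])
    then show False using m(1) by (simp add: mm)
  qed
  have T\<eta>: "T \<eta> = 0" using Tm by (simp add: \<eta>_def)
  define e where "e = inverse \<eta>"
  have e: "\<eta> * e = 1" "e \<noteq> 0" using \<eta> by (simp_all add: e_def)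
  \<comment> \<open>The value \<open>- 1\<close> balances the terms with \<open>e\<close> in the
    trace relation of \<open>b\<close> and so fixes \<open>dot f (sg 4 b)\<close>;
    \<open>T s \<noteq> 0\<close> will give injectivity of \<open>f\<close> on
    \<open>V\<close>.\<close>
  obtain s where s: "T (s * m) = - 1" "T s \<noteq> 0" using ex_trace_pair[OF m(1)] by blast
  \<comment> \<open>in the coordinates \<open>f, sg 1 f, \<dots>, sg 4 f\<close>, the vector \<open>b\<close> becomes \<open>(e + s, s, s, fr 3 e + s, s)\<close>\<close>
  obtain f where f0: "dot f b = e + s" and f1: "dot f (sg 1 b) = fr 1 s" and f2: "dot f (sg 2 b) = e + fr 2 s"
    and f3: "dot f (sg 3 b) = fr 3 s" and fv0: "dot f v0 = - e"
    using orbit_and_vector_prescribed[OF b4 td(1,3), of v0] tdv0 by (metis one_neq_zero)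
  have f4: "dot f (sg 4 b) = fr 4 s"
  proof -
    have "m * (e + s) + fr 1 m * fr 1 s + fr 2 m * (e + fr 2 s) + fr 3 m * fr 3 s + fr 4 m * dot f (sg 4 b) = 0"
      using arg_cong[OF m(2), of "dot f"]
      by (simp add: TV_def f0 f1[unfolded One_nat_def] f2 f3)
    moreover have "s * m + fr 1 s * fr 1 m + fr 2 s * fr 2 m + fr 3 s * fr 3 m + fr 4 s * fr 4 m = - 1"
      using s(1) by (simp add: T_eq)
    moreover have "m * e + fr 2 m * e = 1" using e(1) by (simp add: \<eta>_def distrib_right)
    ultimately have "fr 4 m * dot f (sg 4 b) = fr 4 m * fr 4 s" by algebra
    then show ?thesis using m(1) by simp
  qed
  note fb = f0 f1 f1[unfolded One_nat_def] f2 f3 f4 fv0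
  have inj: "v = 0" if v: "v \<in> V" "dot f v = 0" for v
  proof -
    obtain x where x: "v = TV (x *s b) + dot td v *s v0"
      using orbit_complement_decomposition[OF b4 td(1,3) tdv0 v0 v(1)] by blast
    define l where "l = dot td v"
    have lF: "l \<in> F" using td v by (auto simp: l_def intro: dot_V_F)
    define n where "n = - T (s * x)"
    have nF: "n \<in> F" by (simp add: n_def)
    have "dot f v = dot f (TV (x *s b)) + l * dot f v0" by (subst x) (simp add: l_def)
    also have "dot f (TV (x *s b)) = e * (x + fr 2 x) + T (s * x)"
      by (simp add: TV_def fb T_eq algebra_simps)
    finally have "e * (x + fr 2 x) - n - l * e = 0" using v(2) fb by (simp add: n_def)
    then have "\<eta> * e * (x + fr 2 x) - n * \<eta> - l * (\<eta> * e) = 0" by algebra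
    then have x2: "x + fr 2 x = l + n * (m + fr 2 m)" 
      unfolding e(1) by (simp add: \<eta>_def algebra_simps)
    \<comment> \<open>Since \<open>\<eta> = m + fr 2 m\<close>, this shift absorbs the term with
      \<open>n\<close>, and \<open>z\<close> is then forced into \<open>F\<close>.\<close>
    define z where "z = x - n * m"
    have z2: "z + fr 2 z = l" using x2 nF by (simp add: z_def fr_F algebra_simps)
    have zF: "z \<in> F" by (rule fr_2_add_self_in_F) (simp add: z2 lF)
    have "- n = T (s * (z + n * m))" by (simp add: n_def z_def)
    also have "s * (z + n * m) = z * s + n * (s * m)" by (simp add: algebra_simps)
    also have "T \<dots> = z * T s - n" using zF nF s by (simp add: T_scale)
    finally have "z = 0" using s(2) by simp
    then have "l = 0" "x = n * m" using z2 by (simp_all add: z_def)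
    then show ?thesis using x nF m(2) by (simp add: l_def TV_scale_F)
  qed
  \<comment> \<open>On \<open>V\<close>, \<open>tc\<close> thus becomes the trace of
    \<open>\<rho>\<close> times the value of \<open>f\<close>, which is the trace term of
    \<open>E_set\<close>.\<close>
  obtain \<rho> where \<rho>: "tc = TV (\<rho> *s f)" using bij_functional_represents[OF inj tc(1)] by blast
  let ?g1 = "\<eta> *s (sg 1 f - f) + tc" and ?g2 = "sg 1 f - sg 4 f"
  have fa: "dot f a = s + fr 1 s" "dot f (sg 1 a) = fr 1 s + fr 2 s" "dot f (sg 2 a) = fr 2 s + fr 3 s"
    "dot f (sg 3 a) = fr 3 s + fr 4 s - e" "dot f (sg 4 a) = fr 4 s + s"
    using v0 by (simp_all add: a sg_V fb)
  have li: "lin_indep 3 (\<lambda>i::nat. if i = 0 then b else if i = 1 then sg 2 b else a)"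
    by (rule lin_indep_triple[where t = td])
      (use orbit_pair_independent[OF b4, of 0 2] td in \<open>auto simp: dot_V_sg\<close>)
  have eqs: "equations ?g2 ?g1"
  proof (rule equationsI[OF li])
    show "dot ?g2 (sg 2 a) \<noteq> 0" using e fa by (simp add: dot_sg_left[unfolded One_nat_def])
    show "dot ?g1 (sg 2 a) = 0" using fa tc by (simp add: dot_sg_left[unfolded One_nat_def] dot_V_sg)
    show "dot ?g1 (sg 4 a) \<noteq> 0"
      using e \<eta> fa tc by (simp add: dot_sg_left[unfolded One_nat_def] dot_V_sg)
  qed (use G tc fa fb e in \<open>auto simp: dot_sg_left[unfolded One_nat_def] dot_V_sg algebra_simps\<close>)
  have bij: "bij_betw (dot f) V UNIV" using inj by (rule bij_betw_dot_V)
  have "T \<rho> \<noteq> 0"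
  proof
    assume "T \<rho> = 0"
    \<comment> \<open>Where \<open>f\<close> has the value 1, so do its conjugates; their
      differences vanish and only \<open>T \<rho>\<close> remains.\<close>
    obtain v where v: "v \<in> V" "dot f v = 1" using bij unfolding bij_betw_def by (metis (no_types, lifting) UNIV_I imageE)
    have "dot tc v = T \<rho>"
      using v by (simp add: \<rho> dot_commute[of _ v] dot_V_TV)
    then have "dot ?g1 v = 0" "dot ?g2 v = 0"
      using v \<open>T \<rho> = 0\<close> by (simp_all add: dot_sg_V)
    then have "v \<in> G" using G_iff[OF eqs] by blast
    then have "v = 0" using v G_V by blast
    then show False using v by simp
  qed
  then show ?thesis using \<eta> T\<eta> bij eqs \<rho> by blast
qed

end

subsection \<open>Collineations\<close>

lemma field_aut_simps:
  assumes "field_aut \<theta>"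
  shows "\<theta> 0 = 0" "\<theta> 1 = 1" "\<theta> (x + y) = \<theta> x + \<theta> y" "\<theta> (x * y) = \<theta> x * \<theta> y"
    "\<theta> (x ^ n) = \<theta> x ^ n" "\<theta> (sum f A) = (\<Sum>i\<in>A. \<theta> (f i))" "\<theta> x = 0 \<longleftrightarrow> x = 0"
proof -
  have inj: "inj \<theta>" using assms by (simp add: field_aut_def bij_is_inj)
  show add: "\<theta> (x + y) = \<theta> x + \<theta> y" and mult: "\<theta> (x * y) = \<theta> x * \<theta> y" for x y
    using assms by (auto simp: field_aut_def)
  have "\<theta> 0 + \<theta> 0 = \<theta> 0 + 0" by (simp only: add_0_right flip: add[of 0 0])
  then show zero: "\<theta> 0 = 0" by (rule add_left_imp_eq)
  show iff: "\<theta> x = 0 \<longleftrightarrow> x = 0" for x using inj_eq[OF inj, of x 0] zero by simp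
  show one: "\<theta> 1 = 1" using mult[of 1 1] iff[of 1] by simp
  show "\<theta> (x ^ n) = \<theta> x ^ n" by (induction n) (auto simp: one mult)
  show "\<theta> (sum f A) = (\<Sum>i\<in>A. \<theta> (f i))"
    by (induction A rule: infinite_finite_induct) (auto simp: zero add)
qed

lemma pt_altdef: "pt v = range (\<lambda>c. c *s v)"
  by (simp add: pt_def vec.span_singleton)

lemma mem_pt: "v \<in> pt v"
  by (simp add: pt_def vec.span_base)

lemma pt_scale: "c \<noteq> 0 \<Longrightarrow> pt (c *s v) = pt v"
  unfolding pt_altdef
proof (intro equalityI subsetI)
  fix x assume "c \<noteq> 0" "x \<in> range (\<lambda>d. d *s v)"
  then obtain d where "x = d *s v" by blast
  then have "x = (d / c) *s (c *s v)" using \<open>c \<noteq> 0\<close> by simp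
  then show "x \<in> range (\<lambda>d. d *s (c *s v))" by blast
qed auto

lemma pt_eqD: "pt v = pt w \<Longrightarrow> \<exists>c. v = c *s w"
  using mem_pt[of v] by (auto simp: pt_altdef)

lemma pt_eqI: "v \<in> pt w \<Longrightarrow> v \<noteq> 0 \<Longrightarrow> pt v = pt w"
proof -
  assume "v \<in> pt w" "v \<noteq> 0"
  then obtain c where "v = c *s w" "c \<noteq> 0" by (auto simp: pt_altdef)
  then show ?thesis by (simp add: pt_scale)
qed

lemma pt_subset_iff: "vec.subspace W \<Longrightarrow> pt v \<subseteq> W \<longleftrightarrow> v \<in> W"
  using mem_pt[of v] by (auto simp: pt_altdef vec.subspace_scale)

definition collineation :: "('a::field \<Rightarrow> 'a) \<Rightarrow> ('a ^ 'n \<Rightarrow> 'a ^ 'n) \<Rightarrow> bool" where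
  "collineation \<theta> f \<longleftrightarrow> field_aut \<theta> \<and> semilinear \<theta> f \<and> bij f"

lemma PGammaL_eq: "PGammaL = {induced f | f \<theta>. collineation \<theta> f}"
  by (simp add: PGammaL_def collineation_def)

lemma collineation_simps:
  assumes "collineation \<theta> f"
  shows "f (u + v) = f u + f v" "f (c *s v) = \<theta> c *s f v" "f 0 = 0" "f v = 0 \<longleftrightarrow> v = 0"
proof -
  have inj: "inj f" using assms by (simp add: collineation_def bij_is_inj)
  show add: "f (u + v) = f u + f v" for u v using assms by (simp add: collineation_def semilinear_def)
  show "f (c *s v) = \<theta> c *s f v" using assms by (simp add: collineation_def semilinear_def)
  show zero: "f 0 = 0" using add[of 0 0] by simp
  show "f v = 0 \<longleftrightarrow> v = 0" using inj_eq[OF inj, of v 0] zero by simp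
qed

lemma collineation_sum: "collineation \<theta> f \<Longrightarrow> f (sum h A) = (\<Sum>i\<in>A. f (h i))"
  by (induction A rule: infinite_finite_induct) (auto simp: collineation_simps)

lemma collineation_image_pt:
  assumes "collineation \<theta> f"
  shows "f ` pt v = pt (f v)"
proof -
  have surj: "surj \<theta>" using assms by (simp add: collineation_def field_aut_def bij_is_surj)
  have "f ` pt v = range (\<lambda>c. \<theta> c *s f v)"
    by (simp add: pt_altdef image_image collineation_simps[OF assms])
  also have "\<dots> = (\<lambda>c. c *s f v) ` range \<theta>" by (simp add: image_image)
  finally show ?thesis by (simp add: surj pt_altdef)
qed

lemma pt_in_pg_points [simp]: "v \<noteq> 0 \<Longrightarrow> pt v \<in> pg_points"
  by (auto simp: pg_points_def)

lemma dim_eq_1_pt: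
  assumes "vec.subspace S" "vec.dim S = 1"
  obtains a where "a \<noteq> 0" "S = pt a"
proof -
  obtain a where a: "a \<in> S" "a \<noteq> 0"
    using assms vec.dim_eq_0[of S] by auto
  have "vec.dim {a} = 1" using a(2) by (simp add: vec.dim_insert)
  then have "vec.span {a} = S"
    using a assms by (intro vec.subspace_dim_equal vec.span_minimal) auto
  then show thesis using that[of a] a by (simp add: pt_def)
qed

lemma points_of_pt: "a \<noteq> 0 \<Longrightarrow> {P \<in> pg_points. P \<subseteq> pt a} = {pt a}"
proof (intro equalityI subsetI)
  fix P assume "P \<in> {P \<in> pg_points. P \<subseteq> pt a}"
  then obtain v where "P = pt v" "v \<noteq> 0" "pt v \<subseteq> pt a" by (auto simp: pg_points_def)
  then have "P = pt a" using mem_pt[of v] by (metis pt_eqI subsetD)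
  then show "P \<in> {pt a}" by simp
qed auto

lemma induced_pt: "collineation \<theta> f \<Longrightarrow> v \<noteq> 0 \<Longrightarrow> induced f (pt v) = pt (f v)"
  by (simp add: induced_def collineation_image_pt)

lemma induced_comp:
  assumes "collineation \<theta> f" "collineation \<eta> g"
  shows "induced f \<circ> induced g = induced (f \<circ> g)"
proof
  fix P
  show "(induced f \<circ> induced g) P = induced (f \<circ> g) P"
  proof (cases "P \<in> pg_points")
    case True
    then obtain v where v: "P = pt v" "v \<noteq> 0" by (auto simp: pg_points_def)
    then have "g ` P \<in> pg_points"
      by (simp add: collineation_image_pt[OF assms(2)] collineation_simps[OF assms(2)])
    then show ?thesis using True by (simp add: induced_def image_image)
  qed (simp add: induced_def)
qed

lemma collineation_comp:
  assumes "collineation \<theta> f" "collineation \<eta> g"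
  shows "collineation (\<theta> \<circ> \<eta>) (f \<circ> g)"
  using assms by (auto simp: collineation_def field_aut_def semilinear_def intro: bij_comp)

lemma collineation_inv:
  assumes "collineation id g"
  shows "collineation id (inv g)"
proof -
  have bij: "bij g" using assms by (simp add: collineation_def)
  have gi: "g (inv g x) = x" for x using bij by (simp add: bij_is_surj surj_f_inv_f)
  have inj: "g x = g y \<longleftrightarrow> x = y" for x y using bij by (simp add: bij_is_inj inj_eq)
  have "inv g (u + v) = inv g u + inv g v" for u v
    by (subst inj[symmetric]) (simp add: collineation_simps[OF assms] gi)
  moreover have "inv g (c *s v) = c *s inv g v" for c v
    by (subst inj[symmetric]) (simp add: collineation_simps[OF assms] gi)
  ultimately show ?thesis
    using bij by (simp add: collineation_def field_aut_def semilinear_def bij_imp_bij_inv)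
qed

section \<open>Collineations fixing the subgeometry pointwise\<close>

context quintic_field
begin

lemma field_aut_fr: "field_aut (fr i)"
proof -
  have "inj (fr i)" by (rule injI) simp
  then show ?thesis by (simp add: field_aut_def bij_def finite_UNIV_inj_surj)
qed

lemma collineation_sg: "collineation (fr i) (sg i :: 'a ^ 'n \<Rightarrow> 'a ^ 'n)"
proof -
  have "inj (sg i :: 'a ^ 'n \<Rightarrow> 'a ^ 'n)" by (rule inj_sg)
  then show ?thesis
    by (simp add: collineation_def field_aut_fr semilinear_def bij_def finite_UNIV_inj_surj)
qed

text \<open>A coincidence of two conjugates means that \<open>y\<close> is fixed by some
  \<open>fr i\<close> with \<open>i\<close> between 1 and 4.\<close>

lemma conjugates_distinct:
  assumes "y \<notin> F"
  shows "inj_on (\<lambda>i. fr i y) {..<5}"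
proof (rule linorder_inj_onI)
  fix i j :: nat assume ij: "i < j" "i \<in> {..<5}" "j \<in> {..<5}"
  show "fr i y \<noteq> fr j y"
  proof
    assume "fr i y = fr j y"
    then have "fr (5 - i + i) y = fr (5 - i + j) y" by (simp only: fr_fr[symmetric])
    moreover have "5 - i + i = 5" "5 - i + j = 5 + (j - i)" using ij by auto
    ultimately have "fr (j - i) y = y" by (simp only: fr_plus_5 fr_5)
    moreover have "j - i \<in> {1, 2, 3, 4}" using ij by auto
    ultimately show False using assms fr_fixed_imp_F by blast
  qed
qed auto

lemma poly_fr:
  assumes "\<And>j. coeff p j \<in> F"
  shows "poly p (fr i y) = fr i (poly p y)"
  using assms by (simp add: poly_altdef fr_sum fr_F)

text \<open>A polynomial over \<open>F\<close> of degree at most 4 that vanishes at \<open>y\<close>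
  vanishes at its five conjugates, so it is 0. Hence the \<open>q ^ 5\<close> choices of
  coefficients give distinct values, which exhaust the field.\<close>

lemma powers_span:
  assumes "y \<notin> F"
  shows "\<exists>c. (\<forall>j. c j \<in> F) \<and> x = (\<Sum>j<5. c j * y ^ j)"
proof -
  let ?P = "\<lambda>c. \<Sum>j<5. monom (c j) j"
  have "inj_on (\<lambda>c. \<Sum>j<5. c j * y ^ j) (PiE {..<5} (\<lambda>_. F))"
  proof (rule inj_onI)
    fix c d assume cd: "c \<in> PiE {..<5} (\<lambda>_. F)" "d \<in> PiE {..<5} (\<lambda>_. F)"
      and eq: "(\<Sum>j<5. c j * y ^ j) = (\<Sum>j<5. d j * y ^ j)"
    let ?p = "?P (\<lambda>j. c j - d j)"
    have coeff: "coeff ?p j = (if j < 5 then c j - d j else 0)" for j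
      by (simp add: coeff_sum)
    have pF: "coeff ?p j \<in> F" for j using cd by (auto simp: coeff PiE_iff)
    have "poly ?p y = 0" using eq by (simp add: poly_sum poly_monom sum_subtractf left_diff_distrib)
    then have roots: "poly ?p (fr i y) = 0" for i using poly_fr[OF pF, of i y] by simp
    have "?p = 0"
    proof (rule ccontr)
      assume "?p \<noteq> 0"
      then have "card ((\<lambda>i. fr i y) ` {..<5}) \<le> degree ?p"
        by (rule card_le_degree_if_roots) (use roots in auto)
      moreover have "degree ?p \<le> 4"
        by (rule degree_le) (auto simp: coeff)
      ultimately show False using conjugates_distinct[OF assms] by (simp add: card_image)
    qed
    then have "c j = d j" if "j < 5" for j using coeff[of j] that by simp
    then show "c = d" using cd by (intro PiE_ext) auto
  qed
  then have "card ((\<lambda>c. \<Sum>j<5. c j * y ^ j) ` PiE {..<5} (\<lambda>_. F)) = card (UNIV :: 'a set)"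
    by (simp add: card_image card_PiE card_F card_K)
  then have "(\<lambda>c. \<Sum>j<5. c j * y ^ j) ` PiE {..<5} (\<lambda>_. F) = UNIV"
    by (intro card_subset_eq) auto
  then obtain c where c: "c \<in> PiE {..<5} (\<lambda>_. F)" "x = (\<Sum>j<5. c j * y ^ j)"
    by (metis (no_types, lifting) UNIV_I imageE)
  then show ?thesis
    by (intro exI[of _ "\<lambda>j. if j < 5 then c j else 0"]) (auto simp: PiE_iff)
qed

text \<open>Any \<open>y\<close> outside \<open>F\<close> generates the field, so an automorphism over \<open>F\<close> is determined by the conjugate of \<open>y\<close> to which it maps \<open>y\<close>.\<close>

lemma field_aut_eq_fr:
  assumes \<theta>: "field_aut \<theta>" and fixF: "\<And>x. x \<in> F \<Longrightarrow> \<theta> x = x"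
  shows "\<exists>i. \<theta> = fr i"
proof -
  note \<theta>_simps = field_aut_simps[OF \<theta>]
  have "F \<noteq> UNIV"
  proof
    assume "F = UNIV"
    then have "q ^ 1 = q ^ 5" using card_F card_K by simp
    then show False using q_ge_2 power_inject_exp[of q 1 5] by simp
  qed
  then obtain y where y: "y \<notin> F" by blast
  obtain c where c: "\<And>j. c j \<in> F" "y ^ 5 = (\<Sum>j<5. c j * y ^ j)" using powers_span[OF y, of "y ^ 5"] by blast
  let ?p = "monom 1 5 - (\<Sum>j<5. monom (c j) j)"
  have coeff: "coeff ?p j = (if j = 5 then 1 else if j < 5 then - c j else 0)" for j
    by (simp add: coeff_sum)
  have root: "poly ?p y = 0" using c(2) by (simp add: poly_sum poly_monom)
  have roots: "poly ?p (fr i y) = 0" for i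
    using poly_fr[of ?p i y] c(1) root by (simp add: coeff del: coeff_diff)
  have "poly ?p (\<theta> y) = \<theta> (y ^ 5) - \<theta> (\<Sum>j<5. c j * y ^ j)"
    using fixF[OF c(1)] by (simp add: poly_sum poly_monom \<theta>_simps)
  then have "poly ?p (\<theta> y) = 0" using c(2) by simp
  moreover have "?p \<noteq> 0"
  proof
    assume "?p = 0"
    then have "coeff ?p 5 = 0" by (simp only: coeff_0)
    then show False unfolding coeff by simp
  qed
  ultimately have "card (insert (\<theta> y) ((\<lambda>i. fr i y) ` {..<5})) \<le> degree ?p"
    by (intro card_le_degree_if_roots) (use roots in auto)
  moreover have "degree ?p \<le> 5" by (rule degree_le) (auto simp: coeff_sum)
  ultimately have "\<theta> y \<in> (\<lambda>i. fr i y) ` {..<5}"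
    using conjugates_distinct[OF y] by (auto simp: card_insert_if card_image split: if_splits)
  then obtain i where i: "\<theta> y = fr i y" by blast
  have "\<theta> x = fr i x" for x
  proof -
    obtain d where d: "\<And>j. d j \<in> F" "x = (\<Sum>j<5. d j * y ^ j)" using powers_span[OF y] by blast
    show ?thesis unfolding d(2) using fixF[OF d(1)] by (simp add: \<theta>_simps fr_sum i fr_F[OF d(1)])
  qed
  then show ?thesis by blast
qed

text \<open>Fixing the coordinate points makes \<open>h\<close> diagonal, fixing the all-one point
  makes the diagonal constant, and the points with one entry \<open>x\<close> in \<open>F\<close>
  and all others 1 show that \<open>\<theta>\<close> fixes \<open>F\<close>.\<close>

lemma collineation_fixing_V_points:
  fixes h :: "'a ^ 5 \<Rightarrow> 'a ^ 5"
  assumes h: "collineation \<theta> h" and fix_pt: "\<And>v. v \<in> V \<Longrightarrow> v \<noteq> 0 \<Longrightarrow> h v \<in> pt v"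
  shows "\<exists>l i. l \<noteq> 0 \<and> h = (\<lambda>w. l *s sg i w)"
proof -
  have \<theta>: "field_aut \<theta>" using h by (simp add: collineation_def)
  note \<theta>_simps = field_aut_simps[OF \<theta>] and h_simps = collineation_simps[OF h] collineation_sum[OF h]
  have axV: "axis k 1 \<in> V" for k by (auto simp: V_def axis_def)
  have "\<exists>d. h (axis k 1) = d *s axis k 1" for k
    using fix_pt[OF axV, of k] by (auto simp: pt_altdef axis_eq_0_iff)
  then obtain d where d: "\<And>k. h (axis k 1) = d k *s axis k 1" by metis
  have expand: "w = (\<Sum>k\<in>UNIV. w $ k *s axis k 1)" for w :: "'a ^ 5"
    by (simp add: basis_expansion)
  have hw: "h w $ k = \<theta> (w $ k) * d k" for w k
  proof -
    have "h w = (\<Sum>k\<in>UNIV. \<theta> (w $ k) *s (d k *s axis k 1))"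
      by (subst expand) (simp add: h_simps d)
    then show ?thesis by (simp add: axis_def if_distrib sum_component cong: if_cong)
  qed
  have "(\<chi> k. 1) \<in> V" "(\<chi> k. 1) \<noteq> (0 :: 'a ^ 5)" by (auto simp: V_def vec_eq_iff)
  from fix_pt[OF this] obtain l where "h (\<chi> k. 1) = l *s (\<chi> k. 1)" by (auto simp: pt_altdef)
  then have dl: "d k = l" for k using hw[of "\<chi> k. 1" k] by (simp add: \<theta>_simps)
  have "l \<noteq> 0"
    using d[of 1] h_simps(4)[of "axis 1 1"] by (auto simp: dl axis_eq_0_iff)
  moreover have "\<theta> x = x" if x: "x \<in> F" for x
  proof -
    let ?w = "(\<chi> k. if k = 1 then x else 1) :: 'a ^ 5"
    have "?w \<in> V" using x by (auto simp: V_def)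
    moreover have "?w $ (2::5) = 1" by simp
    then have "?w \<noteq> 0" by (metis zero_index zero_neq_one)
    ultimately obtain c where c: "h ?w = c *s ?w" using fix_pt[of ?w] by (auto simp: pt_altdef)
    have "c = l" using arg_cong[OF c, of "\<lambda>w. w $ 2"] by (simp add: hw dl \<theta>_simps)
    then show ?thesis using arg_cong[OF c, of "\<lambda>w. w $ 1"] \<open>l \<noteq> 0\<close> by (simp add: hw dl)
  qed
  then obtain i where "\<theta> = fr i" using field_aut_eq_fr[OF \<theta>] by blast
  then have "h = (\<lambda>w. l *s sg i w)" by (auto simp: fun_eq_iff vec_eq_iff hw dl)
  ultimately show ?thesis by blast
qed

text \<open>The powers of the Frobenius map, transported to the subgeometry whose points are the
  images under \<open>g\<close> of those of \<open>V\<close>.\<close>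

definition frob :: "('a ^ 5 \<Rightarrow> 'a ^ 5) \<Rightarrow> nat \<Rightarrow> 'a ^ 5 \<Rightarrow> 'a ^ 5" where
  "frob g i w = g (sg i (inv g w))"

context
  fixes g :: "'a ^ 5 \<Rightarrow> 'a ^ 5"
  assumes g: "collineation id g"
begin

lemma inv_g [simp]: "inv g (g x) = x" "g (inv g x) = x"
  using g by (simp_all add: collineation_def bij_is_inj bij_is_surj surj_f_inv_f)

lemma collineation_frob: "collineation (fr i) (frob g i)"
proof -
  have "frob g i = g \<circ> (sg i \<circ> inv g)" by (simp add: fun_eq_iff frob_def)
  then show ?thesis
    using collineation_comp[OF g collineation_comp[OF collineation_sg[of i] collineation_inv[OF g]]]
    by simp
qed

lemma induced_frob_power: "induced (frob g 1) ^^ i = induced (frob g i)"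
proof (induction i)
  case 0
  have "frob g 0 = (\<lambda>x. x)" by (simp add: fun_eq_iff frob_def)
  then show ?case by (simp add: fun_eq_iff induced_def)
next
  case (Suc i)
  have "frob g 1 \<circ> frob g i = frob g (Suc i)" by (simp add: fun_eq_iff frob_def)
  then show ?case
    using Suc induced_comp[OF collineation_frob collineation_frob, of 1 i] by simp
qed

text \<open>Conjugation by \<open>g\<close> reduces the stabilizer to maps fixing the points of
  \<open>V\<close>. These are scalar multiples of powers of the Frobenius map, and scalars act
  trivially on points.\<close>

lemma group_generator_frob:
  assumes S: "S = {pt (g v) | v. v \<in> V \<and> v \<noteq> 0}"
  shows "group_generator (pointwise_stabilizer S) (induced (frob g 1))"
proof -
  have mem: "induced (frob g i) \<in> pointwise_stabilizer S" for i
  proof -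
    have "induced (frob g i) (pt (g v)) = pt (g v)" if "v \<in> V" "v \<noteq> 0" for v
      using that induced_pt[OF collineation_frob, of "g v" i]
      by (simp add: collineation_simps[OF g] frob_def sg_V)
    then show ?thesis
      using collineation_frob[of i] by (auto simp: pointwise_stabilizer_def PGammaL_eq S)
  qed
  moreover have "\<exists>i. \<psi> = induced (frob g i)" if psi: "\<psi> \<in> pointwise_stabilizer S" for \<psi>
  proof -
    obtain f \<theta> where f: "\<psi> = induced f" "collineation \<theta> f"
      using psi by (auto simp: pointwise_stabilizer_def PGammaL_eq)
    define h where "h = inv g \<circ> (f \<circ> g)"
    have h: "collineation \<theta> h"
      using collineation_comp[OF collineation_inv[OF g] collineation_comp[OF f(2) g]]
      by (simp add: h_def)
    have "h v \<in> pt v" if v: "v \<in> V" "v \<noteq> 0" for v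
    proof -
      have "\<psi> (pt (g v)) = pt (g v)" using psi v by (auto simp: pointwise_stabilizer_def S)
      then have "pt (f (g v)) = pt (g v)"
        using v f by (simp add: induced_pt collineation_simps[OF g])
      then obtain c where "f (g v) = c *s g v" using pt_eqD by blast
      then show ?thesis
        using collineation_simps(2)[OF collineation_inv[OF g], of c "g v"]
        by (auto simp: h_def pt_altdef)
    qed
    from collineation_fixing_V_points[OF h this]
    obtain l i where li: "l \<noteq> 0" "h = (\<lambda>w. l *s sg i w)" by blast
    have fw: "f w = l *s frob g i w" for w
    proof -
      have "f w = g (h (inv g w))" by (simp add: h_def)
      then show ?thesis by (simp add: li frob_def collineation_simps[OF g])
    qed
    have "induced f P = induced (frob g i) P" for P
    proof (cases "P \<in> pg_points")
      case True
      then obtain v where "P = pt v" "v \<noteq> 0" by (auto simp: pg_points_def)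
      then show ?thesis
        using li by (simp add: induced_pt[OF f(2)] induced_pt[OF collineation_frob] fw pt_scale)
    qed (simp add: induced_def)
    then show ?thesis using f(1) by blast
  qed
  ultimately show ?thesis
    unfolding group_generator_def using induced_frob_power by auto
qed

end

end

subsection \<open>Projections\<close>

lemma collineation_id_linear: "collineation id f \<Longrightarrow> Vector_Spaces.linear (*s) (*s) f"
  by unfold_locales (auto simp: collineation_simps)

lemma vector_2_eq_0_iff: "vector [x, y] = (0 :: 'a::field ^ 2) \<longleftrightarrow> x = 0 \<and> y = 0"
  by (auto simp: vec_eq_iff forall_2)

lemma vector_2_scale: "vector [c * x, c * y] = c *s (vector [x, y] :: 'a::field ^ 2)"
  by (simp add: vec_eq_iff forall_2)

lemma card_eq_if_PGammaL_equiv: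
  assumes "PGammaL_equiv L R" "L \<subseteq> pg_points"
  shows "card R = card L"
proof -
  obtain f \<theta> where f: "collineation \<theta> f" "induced f ` L = R"
    using assms(1) by (auto simp: PGammaL_equiv_def PGammaL_eq)
  have "inj f" using f(1) by (simp add: collineation_def bij_is_inj)
  then have "inj_on (induced f) L"
    using assms(2) by (auto simp: inj_on_def induced_def inj_image_eq_iff)
  then show ?thesis using f(2) card_image by blast
qed

text \<open>Projecting from \<open>\<Gamma>\<close> means passing to vectors modulo
  \<open>G0\<close>, and \<open>(A, B)\<close> are coordinates on that quotient. Since
  \<open>\<Lambda>\<close> is disjoint from \<open>\<Gamma>\<close>, they differ from the
  coordinates \<open>c\<close> by a linear bijection.\<close>

lemma projection_equiv:
  fixes c :: "'a::{field,finite} ^ 2 \<Rightarrow> 'a ^ 'n"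
  assumes G0: "vec.subspace G0" and \<Gamma>: "\<Gamma> = {P \<in> pg_points. P \<subseteq> G0}"
    and disj: "\<Gamma> \<inter> \<Lambda> = {}" and c: "line_coordinates c \<Lambda>"
    and A: "\<And>x y. A (x + y) = A x + A y" "\<And>k x. A (k *s x) = k * A x"
    and B: "\<And>x y. B (x + y) = B x + B y" "\<And>k x. B (k *s x) = k * B x"
    and ker: "\<And>w. w \<in> G0 \<longleftrightarrow> A w = 0 \<and> B w = 0"
    and X: "\<And>w. w \<in> X \<Longrightarrow> w \<notin> G0"
    and L: "L = {P \<in> pg_points. c ` P \<in> pg_projection \<Gamma> \<Lambda> {pt w | w. w \<in> X}}"
  shows "PGammaL_equiv L {pt (vector [A w, B w]) | w. w \<in> X}"
proof -
  have c_add: "c (x + y) = c x + c y" and c_scale: "c (k *s x) = k *s c x" for x y k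
    using c by (auto simp: line_coordinates_def semilinear_def)
  have c_inj: "c x = c y \<longleftrightarrow> x = y" for x y using c by (auto simp: line_coordinates_def inj_eq)
  have c_0: "c 0 = 0" using c_add[of 0 0] by simp
  have c_eq_0: "c x = 0 \<longleftrightarrow> x = 0" for x using c_inj[of x 0] c_0 by simp
  have c_pt: "c ` pt u = pt (c u)" for u by (simp add: pt_altdef image_image c_scale)
  have \<Lambda>: "\<Lambda> = {pt (c u) | u. u \<noteq> 0}"
  proof -
    have "\<Lambda> = (\<lambda>P. c ` P) ` pg_points" using c by (simp add: line_coordinates_def)
    also have "\<dots> = {c ` pt u | u. u \<noteq> 0}" by (auto simp: pg_points_def)
    finally show ?thesis by (simp only: c_pt)
  qed
  \<comment> \<open>This is the change between the two systems of coordinates; disjointness gives it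
    trivial kernel.\<close>
  define M where "M u = (vector [A (c u), B (c u)] :: 'a ^ 2)" for u
  have M_add: "M (x + y) = M x + M y" for x y
    by (simp add: M_def c_add A B vec_eq_iff forall_2)
  have M_scale: "M (k *s x) = k *s M x" for k x
    by (simp add: M_def c_scale A B vector_2_scale)
  have M_0: "M u = 0 \<longleftrightarrow> u = 0" for u
  proof
    assume "M u = 0"
    then have "c u \<in> G0" by (simp add: M_def vector_2_eq_0_iff ker)
    show "u = 0"
    proof (rule ccontr)
      assume "u \<noteq> 0"
      then have "pt (c u) \<in> \<Lambda>" by (auto simp: \<Lambda>)
      moreover have "pt (c u) \<in> \<Gamma>"
        using \<open>c u \<in> G0\<close> \<open>u \<noteq> 0\<close> by (simp add: \<Gamma> pt_subset_iff[OF G0] c_eq_0)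
      ultimately show False using disj by blast
    qed
  next
    assume "u = 0"
    then show "M u = 0" using M_add[of 0 0] by simp
  qed
  have "inj M"
  proof (rule injI)
    fix x y assume "M x = M y"
    then have "M (x - y) = 0"
      using M_add[of "x - y" y] by simp
    then show "x = y" by (simp add: M_0)
  qed
  then have "bij M" by (simp add: bij_def finite_UNIV_inj_surj)
  then have M: "collineation id M"
    by (simp add: collineation_def semilinear_def M_add M_scale field_aut_def)
  have in_span: "\<exists>l. x - l *s w \<in> G0" if x: "x \<in> vec.span (\<Union>(insert (pt w) \<Gamma>))" for x w
    using x
  proof (induction rule: vec.span_induct_alt)
    case base
    then show ?case using vec.subspace_0[OF G0] by (intro exI[of _ 0]) simp
  next
    case (step k x y)
    obtain l where l: "y - l *s w \<in> G0" using step by blast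
    have "\<exists>l. x - l *s w \<in> G0"
    proof (cases "x \<in> pt w")
      case True
      then obtain l where "x = l *s w" by (auto simp: pt_altdef)
      then show ?thesis using vec.subspace_0[OF G0] by (intro exI[of _ l]) simp
    next
      case False
      then have "x \<in> G0" using step(1) by (auto simp: \<Gamma>)
      then show ?thesis by (intro exI[of _ 0]) simp
    qed
    then obtain l' where "x - l' *s w \<in> G0" by blast
    then have "k *s (x - l' *s w) + (y - l *s w) \<in> G0"
      using l by (intro vec.subspace_add[OF G0] vec.subspace_scale[OF G0])
    moreover have "k *s (x - l' *s w) + (y - l *s w) = (k *s x + y) - (k * l' + l) *s w"
      by (simp add: vec_eq_iff algebra_simps)
    ultimately show ?case by metis
  qed
  have M_eq: "M u = l *s vector [A w, B w]" if "c u - l *s w \<in> G0" for u l w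
  proof -
    have "A (c u) = A (c u - l *s w) + l * A w" "B (c u) = B (c u - l *s w) + l * B w"
      using A(1)[of "c u - l *s w" "l *s w"] B(1)[of "c u - l *s w" "l *s w"] by (simp_all add: A(2) B(2))
    then show ?thesis using that by (simp add: M_def ker vector_2_scale)
  qed
  have "induced M ` L = {pt (vector [A w, B w]) | w. w \<in> X}" (is "_ = ?R")
  proof (intro equalityI subsetI)
    fix Q assume "Q \<in> induced M ` L"
    then obtain P where P: "P \<in> L" "Q = induced M P" by blast
    then obtain u where u: "P = pt u" "u \<noteq> 0" by (auto simp: L pg_points_def)
    have "pt (c u) \<in> pg_projection \<Gamma> \<Lambda> {pt w | w. w \<in> X}" using P(1) by (simp add: L u c_pt)
    then obtain w where w: "w \<in> X" "pg_span (insert (pt w) \<Gamma>) \<inter> \<Lambda> = {pt (c u)}"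
      by (auto simp: pg_projection_def)
    then have "pt (c u) \<subseteq> vec.span (\<Union>(insert (pt w) \<Gamma>))" by (auto simp: pg_span_def)
    then obtain l where "c u - l *s w \<in> G0" using in_span mem_pt by blast
    then have Mu: "M u = l *s vector [A w, B w]" by (rule M_eq)
    then have "l \<noteq> 0" using M_0[of u] u(2) by auto
    then have "Q = pt (vector [A w, B w])" using P(2) u by (simp add: induced_pt[OF M] Mu pt_scale)
    then show "Q \<in> ?R" using w(1) by blast
  next
    fix Q assume "Q \<in> ?R"
    then obtain w where w: "w \<in> X" "Q = pt (vector [A w, B w])" by blast
    \<comment> \<open>Surjectivity of \<open>M\<close> supplies the vector on the line that is
      congruent to \<open>w\<close> modulo \<open>G0\<close>.\<close>
    obtain u where u: "M u = vector [A w, B w]"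
      using \<open>bij M\<close> by (metis bij_pointE)
    have nz: "vector [A w, B w] \<noteq> (0 :: 'a ^ 2)" using X[OF w(1)] ker by (simp add: vector_2_eq_0_iff)
    then have u0: "u \<noteq> 0" unfolding u[symmetric] M_0 .
    have "A (c u) = A w" "B (c u) = B w"
      using arg_cong[OF u, of "\<lambda>v. v $ 1"] arg_cong[OF u, of "\<lambda>v. v $ 2"] by (simp_all add: M_def)
    moreover have "A (c u) = A (c u - w) + A w" "B (c u) = B (c u - w) + B w"
      using A(1)[of "c u - w" w] B(1)[of "c u - w" w] by simp_all
    ultimately have d: "c u - w \<in> G0" by (simp add: ker)
    have "pg_span (insert (pt w) \<Gamma>) \<inter> \<Lambda> = {pt (c u)}"
    proof (intro equalityI subsetI)
      fix P assume P: "P \<in> pg_span (insert (pt w) \<Gamma>) \<inter> \<Lambda>"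
      then obtain u' where u': "P = pt (c u')" "u' \<noteq> 0" by (auto simp: \<Lambda>)
      have "pt (c u') \<subseteq> vec.span (\<Union>(insert (pt w) \<Gamma>))" using P u' by (auto simp: pg_span_def)
      then obtain l where "c u' - l *s w \<in> G0" using in_span mem_pt by blast
      then have "M u' = M (l *s u)" using M_eq by (simp add: M_scale u)
      then have "u' = l *s u" using \<open>inj M\<close> by (simp add: inj_eq)
      moreover from this have "l \<noteq> 0" using u'(2) by auto
      ultimately show "P \<in> {pt (c u)}" using u' by (simp add: c_scale pt_scale)
    next
      fix P assume "P \<in> {pt (c u)}"
      then have P: "P = pt (c u)" by simp
      let ?S = "vec.span (\<Union>(insert (pt w) \<Gamma>))"
      have "w \<in> ?S" using mem_pt by (intro vec.span_base) auto
      moreover have "c u - w \<in> ?S"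
      proof (cases "c u - w = 0")
        case False
        then have "pt (c u - w) \<in> \<Gamma>" using d by (simp add: \<Gamma> pt_subset_iff[OF G0])
        then show ?thesis using mem_pt by (intro vec.span_base) auto
      qed (simp add: vec.span_zero)
      ultimately have "w + (c u - w) \<in> ?S" by (rule vec.span_add)
      then have "c u \<in> ?S" by simp
      then have "P \<subseteq> ?S" unfolding P by (simp only: pt_subset_iff[OF vec.subspace_span])
      then show "P \<in> pg_span (insert (pt w) \<Gamma>) \<inter> \<Lambda>"
        using u0 by (auto simp: pg_span_def P \<Lambda> c_eq_0)
    qed
    then have "pt u \<in> L" using w(1) u0 by (auto simp: L c_pt pg_projection_def)
    moreover have "Q = induced M (pt u)" using u0 by (simp add: induced_pt[OF M] u w(2))
    ultimately show "Q \<in> induced M ` L" by blast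
  qed
  moreover have "induced M \<in> PGammaL" using M by (auto simp: PGammaL_eq)
  ultimately show ?thesis unfolding PGammaL_equiv_def by blast
qed

context quintic_field
begin

text \<open>For a vector \<open>e\<close> of \<open>V\<close> with \<open>dot t e = 1\<close>, the
  \<open>q\<close> translates by multiples of \<open>e\<close> over \<open>F\<close> are disjoint
  subsets of \<open>V\<close>.\<close>

lemma card_affine_hyperplane_le:
  fixes t :: "'a ^ 5"
  assumes "t \<in> V" "t \<noteq> 0"
  shows "card {v \<in> V. dot t v = 1} \<le> q ^ 4"
proof -
  obtain k where k: "t $ k \<noteq> 0" using assms(2) by (auto simp: vec_eq_iff)
  define e :: "'a ^ 5" where "e = inverse (t $ k) *s axis k 1"
  have te: "dot t e = 1" using k by (simp add: e_def dot_axis)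
  have "axis k 1 \<in> V" by (auto simp: V_def axis_def)
  moreover have "inverse (t $ k) \<in> F" using assms(1) by (auto simp: V_def)
  ultimately have eV: "e \<in> V" unfolding e_def by (intro V_closed)
  have "inj_on (\<lambda>(v, l). v - l *s e) ({v \<in> V. dot t v = 1} \<times> F)"
  proof (rule inj_onI, clarify)
    fix v v' l l' assume v: "dot t v = 1" "dot t v' = 1" and eq: "v - l *s e = v' - l' *s e"
    from arg_cong[OF eq, of "dot t"] have "l = l'" by (simp add: v te)
    then show "v = v' \<and> l = l'" using eq by simp
  qed
  moreover have "(\<lambda>(v, l). v - l *s e) ` ({v \<in> V. dot t v = 1} \<times> F) \<subseteq> V"
    using eV by (auto intro!: V_closed)
  ultimately have "card ({v \<in> V. dot t v = 1} \<times> F) \<le> card (V :: ('a ^ 5) set)"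
    by (intro card_inj_on_le) auto
  then have "card {v \<in> V. dot t v = 1} * q \<le> q ^ 4 * q"
    by (simp add: card_cartesian_product card_F card_V eval_nat_numeral mult_ac)
  then show ?thesis using q_ge_2 by simp
qed

text \<open>A hyperplane over \<open>F\<close> through the plane would leave at most
  \<open>q ^ 4 + 1\<close> projected points; a maximum scattered linear set has more.\<close>

lemma scattered_count_gt: "q ^ 4 + 1 < (q ^ 5 - 1) div (q - 1)"
proof -
  obtain n where n: "q = Suc n" "n > 0" using q_ge_2 by (cases q) auto
  have "q ^ 5 - 1 = n * (q ^ 4 + q ^ 3 + q ^ 2 + q + 1)"
    unfolding n by (simp add: eval_nat_numeral algebra_simps)
  then have "(q ^ 5 - 1) div (q - 1) = q ^ 4 + q ^ 3 + q ^ 2 + q + 1"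
    using n by simp
  then show ?thesis using n by simp
qed

lemma reparametrise:
  assumes "bij_betw (dot f) V UNIV" "\<And>v. v \<in> V \<Longrightarrow> A v = H (dot f v)"
  shows "{A v | v. v \<in> V \<and> v \<noteq> 0} = {H x | x. x \<noteq> 0}"
proof -
  have inj: "v = 0" if "v \<in> V" "dot f v = 0" for v
    using assms(1) that V_closed(1) unfolding bij_betw_def inj_on_def by (metis dot_simps(8))
  have surj: "\<exists>v\<in>V. x = dot f v" for x
    using assms(1) unfolding bij_betw_def by (metis UNIV_I imageE)
  show ?thesis
  proof (intro equalityI subsetI)
    fix P assume "P \<in> {A v | v. v \<in> V \<and> v \<noteq> 0}"
    then show "P \<in> {H x | x. x \<noteq> 0}" using assms(2) inj by blast
  next
    fix P assume "P \<in> {H x | x. x \<noteq> 0}"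
    then obtain x where "P = H x" "x \<noteq> 0" by blast
    moreover obtain v where "v \<in> V" "x = dot f v" using surj by blast
    ultimately show "P \<in> {A v | v. v \<in> V \<and> v \<noteq> 0}"
      using assms(2)[of v] by (intro CollectI exI[of _ v]) auto
  qed
qed

end

subsection \<open>Classification\<close>

context external_plane
begin

text \<open>Two three-dimensional subspaces of a five-dimensional space meet nontrivially.\<close>

lemma plane_meets_conjugate:
  assumes "i \<le> 5"
  shows "vec.dim (G \<inter> sg i ` G) \<ge> 1"
proof -
  have "vec.dim {x + y |x y. x \<in> G \<and> y \<in> sg i ` G} + vec.dim (G \<inter> sg i ` G) = 6"
    using vec.dim_sums_Int[OF subspace_G subspace_sg_image[OF subspace_G assms]] dim_G
      dim_sg_image[OF assms, of G] by simp
  then show ?thesis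
    using dim_subset_UNIV_cart_gen[of "{x + y |x y. x \<in> G \<and> y \<in> sg i ` G}"] by simp
qed

lemma classification:
  assumes rank: "\<And>a b. a \<noteq> 0 \<Longrightarrow> b \<noteq> 0 \<Longrightarrow> G \<inter> sg 4 ` G = pt a \<Longrightarrow> G \<inter> sg 3 ` G = pt b \<Longrightarrow>
    vec.dim ((\<lambda>j. sg j a) ` {..<5}) = 4 \<and> vec.dim ((\<lambda>j. sg j b) ` {..<5}) = 4"
  obtains (pseudoregulus) f s where "s \<in> {3, 4}" "bij_betw (dot f) V UNIV" "equations f (sg s f)"
  | (LF) f k where "Nm q k = 1" "bij_betw (dot f) V UNIV"
    "equations (k *s (sg 1 f + sg 3 f) + sg 2 f + sg 4 f) f"
  | (E) f \<eta> \<rho> where "\<eta> \<noteq> 0" "T \<eta> = 0" "T \<rho> \<noteq> 0" "bij_betw (dot f) V UNIV"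
    "equations (sg 1 f - sg 4 f) (\<eta> *s (sg 1 f - f) + TV (\<rho> *s f))"
proof (cases "\<exists>s\<in>{3, 4}. vec.dim (G \<inter> sg s ` G) \<ge> 2")
  case True
  then show thesis using pseudoregulus_equations pseudoregulus by blast
next
  case False
  have sub: "vec.subspace (G \<inter> sg i ` G)" if "i \<le> 5" for i
    using that subspace_G subspace_sg_image by (intro vec.subspace_inter) auto
  have dims: "vec.dim (G \<inter> sg 4 ` G) = 1" "vec.dim (G \<inter> sg 3 ` G) = 1"
    using plane_meets_conjugate[of 4] plane_meets_conjugate[of 3] False by force+
  obtain a where a: "a \<noteq> 0" "G \<inter> sg 4 ` G = pt a"
    using dim_eq_1_pt[OF sub dims(1)] by auto
  obtain b where b: "b \<noteq> 0" "G \<inter> sg 3 ` G = pt b"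
    using dim_eq_1_pt[OF sub dims(2)] by auto
  \<comment> \<open>\<open>sg 1\<close> and \<open>sg 2\<close> invert \<open>sg 4\<close> and
    \<open>sg 3\<close>, so they carry the conjugate planes back to \<open>G\<close>.\<close>
  have G: "a \<in> G" "sg 1 a \<in> G" "b \<in> G" "sg 2 b \<in> G"
  proof -
    have "a \<in> G \<inter> sg 4 ` G" "b \<in> G \<inter> sg 3 ` G" using a b mem_pt by auto
    then show "a \<in> G" "sg 1 a \<in> G" "b \<in> G" "sg 2 b \<in> G" by auto
  qed
  obtain a b tc td y where n: "a \<in> G" "sg 1 a \<in> G" "b \<in> G" "sg 2 b \<in> G"
    "lin_indep 4 (\<lambda>j. sg j a)" "lin_indep 4 (\<lambda>j. sg j b)"
    "tc \<in> V" "td \<in> V" "dot tc a = 0" "dot tc b = 1" "dot td a = 1" "dot td b = 0"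
    "y \<noteq> 0" "sg 2 b - b = y *s (sg 1 a - a)"
    using normal_form[OF G] rank[OF a(1) b(1) a(2) b(2)] by blast
  show thesis
  proof (cases "y \<in> F")
    case False
    then show thesis using LF_equations[OF n(1-3,5,7,9,10) False n(14)] LF by blast
  next
    case True
    \<comment> \<open>Scalars from \<open>F\<close> commute with the Frobenius map, so dividing
      \<open>b\<close> by \<open>y\<close> turns the factor in the relation into 1;
      \<open>tc\<close> is rescaled to compensate.\<close>
    define b' where "b' = inverse y *s b"
    have "inverse y \<noteq> 0" using n(13) by simp
    have iy: "fr i (inverse y) = inverse y" for i using True by (simp add: fr_F)
    have "b' \<in> G" "sg 2 b' \<in> G"
      using n(3,4) subspace_G iy by (auto simp: b'_def vec.subspace_scale simp del: fr_inverse)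
    moreover have "lin_indep 4 (\<lambda>j. sg j b')"
      unfolding b'_def by (rule lin_indep_orbit_scale[OF n(6) \<open>inverse y \<noteq> 0\<close>])
    moreover have "y *s tc \<in> V" "dot (y *s tc) a = 0" "dot (y *s tc) b' = 1" "dot td b' = 0"
      using n True by (auto simp: b'_def V_closed)
    moreover have "sg 2 b' - b' = inverse y *s (sg 2 b - b)"
      using iy by (simp add: b'_def vec.scale_right_diff_distrib del: fr_inverse)
    then have "sg 2 b' - b' = sg 1 a - a" using n(13,14) by simp
    ultimately show thesis using E_equations[OF n(1) _ _ _ _ _ _ n(8,11)] E by blast
  qed
qed

end

section \<open>Transfer along the coordinate change \<open>g\<close>\<close>

context quintic_field
begin

context
  fixes g :: "'a ^ 5 \<Rightarrow> 'a ^ 5" and G0 G :: "('a ^ 5) set"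
  assumes g: "collineation id g" and G0: "vec.subspace G0" and G: "G = {x. g x \<in> G0}"
begin

lemma G_eq_image: "G = inv g ` G0"
proof (intro equalityI subsetI)
  fix x assume "x \<in> G"
  then show "x \<in> inv g ` G0" by (intro image_eqI[of _ _ "g x"]) (simp_all add: G inv_g[OF g])
qed (auto simp: G inv_g[OF g])

lemma subspace_pullback: "vec.subspace G"
  using G0 by (auto simp: G vec.subspace_def collineation_simps[OF g])

lemma dim_pullback: "vec.dim G = vec.dim G0"
proof -
  have "inj (inv g)" using g by (simp add: collineation_def bij_imp_bij_inv bij_is_inj)
  then show ?thesis
    unfolding G_eq_image
    by (intro vec.dim_image_eq[OF collineation_id_linear[OF collineation_inv[OF g]]])
      (simp add: inj_on_def inj_def)
qed

lemma subspace_image: "vec.subspace S \<Longrightarrow> vec.subspace (g ` S)"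
  using vec.linear_subspace_image[OF collineation_id_linear[OF g]] by blast

text \<open>\<open>frob g i\<close> is \<open>sg i\<close> conjugated by \<open>g\<close>, so the
  intersection can be computed in the coordinates of \<open>V\<close> and carried back by
  \<open>g\<close>.\<close>

lemma plane_inter_frob:
  assumes \<Gamma>: "\<Gamma> = {P \<in> pg_points. P \<subseteq> G0}" and i: "i \<le> 5"
  shows "\<Gamma> \<inter> (induced (frob g 1) ^^ i) ` \<Gamma> = {P \<in> pg_points. P \<subseteq> g ` (G \<inter> sg i ` G)}"
proof (intro equalityI subsetI)
  have sub: "vec.subspace (g ` (G \<inter> sg i ` G))"
    by (intro subspace_image vec.subspace_inter subspace_pullback subspace_sg_image i)
  note g_simps = collineation_simps[OF g] inv_g[OF g]
  note sg_pt = induced_frob_power[OF g] induced_pt[OF collineation_frob[OF g]]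
  {
    fix P assume P: "P \<in> \<Gamma> \<inter> (induced (frob g 1) ^^ i) ` \<Gamma>"
    then obtain Q where Q: "Q \<in> \<Gamma>" "P = induced (frob g i) Q"
      unfolding induced_frob_power[OF g] by blast
    then obtain w where w: "w \<noteq> 0" "w \<in> G0" "P = induced (frob g i) (pt w)"
      by (auto simp: \<Gamma> pg_points_def pt_subset_iff[OF G0])
    define u where "u = frob g i w"
    have Pu: "P = pt u" using w by (simp add: u_def sg_pt)
    moreover have "u \<in> G0" using P Pu mem_pt[of u] by (auto simp: \<Gamma>)
    then have "inv g u \<in> G" by (simp add: G g_simps)
    moreover have "inv g w \<in> G" using w by (simp add: G g_simps)
    moreover have "inv g u = sg i (inv g w)" by (simp add: u_def frob_def g_simps)
    ultimately have "inv g u \<in> G \<inter> sg i ` G" by auto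
    then have "g (inv g u) \<in> g ` (G \<inter> sg i ` G)" by (rule imageI)
    then have "u \<in> g ` (G \<inter> sg i ` G)" by (simp only: g_simps)
    then show "P \<in> {P \<in> pg_points. P \<subseteq> g ` (G \<inter> sg i ` G)}"
      using P Pu by (simp add: pt_subset_iff[OF sub] \<Gamma>)
  }
  {
    fix P assume "P \<in> {P \<in> pg_points. P \<subseteq> g ` (G \<inter> sg i ` G)}"
    then obtain v where v: "P = pt v" "v \<noteq> 0" "v \<in> g ` (G \<inter> sg i ` G)"
      by (auto simp: pg_points_def pt_subset_iff[OF sub])
    then obtain z z' where z: "v = g z" "z \<in> G" "z = sg i z'" "z' \<in> G" by blast
    then have "z' \<noteq> 0" using v by (auto simp: g_simps)
    then have "pt (g z') \<in> \<Gamma>" using z by (simp add: \<Gamma> pt_subset_iff[OF G0] G g_simps)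
    moreover have "P = induced (frob g i) (pt (g z'))"
      using z v \<open>z' \<noteq> 0\<close> by (simp add: sg_pt g_simps frob_def)
    moreover have "P \<in> \<Gamma>" using z v by (simp add: \<Gamma> pt_subset_iff[OF G0] G)
    ultimately show "P \<in> \<Gamma> \<inter> (induced (frob g 1) ^^ i) ` \<Gamma>"
      unfolding induced_frob_power[OF g] by blast
  }
qed

end

text \<open>The summand 1 in \<open>pt_rank\<close> cancels the shift in \<open>pg_dim\<close>, so
  the rank is the vector space dimension of the orbit's span, which \<open>g\<close>
  preserves.\<close>

lemma pt_rank_frob:
  assumes g: "collineation id g" and "a \<noteq> 0"
  shows "pt_rank (induced (frob g 1)) (pt (g a)) = int (vec.dim ((\<lambda>j. sg j a) ` {..<5}))"
proof -
  let ?U = "(\<lambda>j. sg j a) ` {..<5}"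
  have orbit: "(induced (frob g 1) ^^ i) (pt (g a)) = pt (g (sg i a))" for i
    using assms induced_pt[OF collineation_frob[OF g], of "g a" i]
    by (simp add: induced_frob_power[OF g, simplified] frob_def collineation_simps[OF g] inv_g[OF g])
  have "{(induced (frob g 1) ^^ i) (pt (g a)) | i. i \<le> 4} = pt ` g ` ?U"
    unfolding orbit by (force simp: image_image)
  moreover have "vec.span (\<Union>(pt ` g ` ?U)) = vec.span (g ` ?U)"
  proof (intro equalityI vec.span_minimal vec.subspace_span)
    show "\<Union>(pt ` g ` ?U) \<subseteq> vec.span (g ` ?U)"
      using vec.span_mono[of "{_}" "g ` ?U"] by (auto simp: pt_def)
    show "g ` ?U \<subseteq> vec.span (\<Union>(pt ` g ` ?U))"
      using mem_pt by (intro order.trans[OF _ vec.span_superset]) blast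
  qed
  then have "vec.dim (\<Union>(pt ` g ` ?U)) = vec.dim (g ` ?U)" by (rule vec.span_eq_dim)
  moreover have "vec.dim (g ` ?U) = vec.dim ?U"
    using g by (intro vec.dim_image_eq[OF collineation_id_linear[OF g]])
      (auto simp: collineation_def bij_def inj_on_def)
  ultimately show ?thesis by (simp add: pt_rank_def pg_dim_def)
qed

end

section \<open>From the projected linear set to its normal forms\<close>

theorem theorem5p3:
  fixes q :: nat
    and \<Sigma> \<Gamma> \<Lambda> :: "('a::{field,finite} ^ 5) set set"
    and c :: "'a ^ 2 \<Rightarrow> 'a ^ 5"
    and L :: "('a ^ 2) set set"
  assumes "primepow q"
    and "CARD('a) = q ^ 5"
    and "canonical_subgeometry q \<Sigma>"
    and "pg_subspace 2 \<Gamma>"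
    and "\<Gamma> \<inter> \<Sigma> = {}"
    and "pg_subspace 1 \<Lambda>"
    and "\<Gamma> \<inter> \<Lambda> = {}"
    and "line_coordinates c \<Lambda>"
    and "L = {P \<in> pg_points. c ` P \<in> pg_projection \<Gamma> \<Lambda> \<Sigma>}"
    and "max_scattered q L"
    and "\<not> pseudoregulus_type q L"
    and "\<And>\<sigma> A B. group_generator (pointwise_stabilizer \<Sigma>) \<sigma> \<Longrightarrow>
           \<Gamma> \<inter> (\<sigma> ^^ 4) ` \<Gamma> = {A} \<Longrightarrow> \<Gamma> \<inter> (\<sigma> ^^ 3) ` \<Gamma> = {B} \<Longrightarrow>
           pt_rank \<sigma> A = 4 \<and> pt_rank \<sigma> B = 4"
  shows "(\<exists>\<eta> \<rho>. \<eta> \<noteq> 0 \<and> Tr q \<eta> = 0 \<and> Tr q \<rho> \<noteq> 0 \<and> PGammaL_equiv L (E_set q \<eta> \<rho>)) \<or>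
         (\<exists>k. Nm q k = 1 \<and> PGammaL_equiv L (LF_set q k))"
proof -
  interpret quintic_field q "TYPE('a)"
    using assms(1,2) by unfold_locales
  obtain g where g: "collineation id g"
    and S: "\<Sigma> = induced g ` {pt v | v. v \<noteq> 0 \<and> (\<forall>i. v $ i \<in> F)}"
    using assms(3)
    by (auto simp: canonical_subgeometry_def PGL_def collineation_def field_aut_def)
  have \<Sigma>: "\<Sigma> = {pt (g v) | v. v \<in> V \<and> v \<noteq> 0}"
  proof -
    have "\<Sigma> = {induced g (pt v) | v. v \<in> V \<and> v \<noteq> 0}" unfolding S V_def by auto
    also have "\<dots> = {pt (g v) | v. v \<in> V \<and> v \<noteq> 0}" by (intro Collect_cong ex_cong1) (auto simp: induced_pt[OF g])
    finally show ?thesis .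
  qed
  obtain G0 where G0: "vec.subspace G0" "vec.dim G0 = 3" and \<Gamma>: "\<Gamma> = {P \<in> pg_points. P \<subseteq> G0}"
    using assms(4) by (auto simp: pg_subspace_def)
  define G where "G = {x. g x \<in> G0}"
  note g_simps = collineation_simps[OF g] collineation_simps[OF collineation_inv[OF g]] inv_g[OF g]
  have G_V: "v = 0" if v: "v \<in> G" "v \<in> V" for v
  proof (rule ccontr)
    assume "v \<noteq> 0"
    then have "pt (g v) \<in> \<Gamma> \<inter> \<Sigma>"
      using v unfolding \<Gamma> \<Sigma> G_def by (auto simp: pt_subset_iff[OF G0(1)] g_simps)
    then show False using assms(5) by blast
  qed
  have equiv: "PGammaL_equiv L {pt (vector [dot f1 v, dot f2 v]) | v. v \<in> V \<and> v \<noteq> 0}"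
    if ker: "\<And>x. x \<in> G \<longleftrightarrow> dot f1 x = 0 \<and> dot f2 x = 0" for f1 f2
  proof -
    let ?X = "{g v | v. v \<in> V \<and> v \<noteq> 0}"
    have "\<Sigma> = {pt w | w. w \<in> ?X}" unfolding \<Sigma> by auto
    then have "PGammaL_equiv L {pt (vector [dot f1 (inv g w), dot f2 (inv g w)]) | w. w \<in> ?X}"
      using assms(9) G_V
      by (intro projection_equiv[OF G0(1) \<Gamma> assms(7,8)]) (auto simp: g_simps ker[symmetric] G_def)
    also have "{pt (vector [dot f1 (inv g w), dot f2 (inv g w)]) | w. w \<in> ?X} =
        {pt (vector [dot f1 (inv g (g v)), dot f2 (inv g (g v))]) | v. v \<in> V \<and> v \<noteq> 0}"
      by blast
    also have "\<dots> = {pt (vector [dot f1 v, dot f2 v]) | v. v \<in> V \<and> v \<noteq> 0}"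
      by (simp only: inv_g[OF g])
    finally show ?thesis .
  qed
  have G: "vec.subspace G" "vec.dim G = 3"
    using subspace_pullback[OF g G0(1) G_def] dim_pullback[OF g G0(1) G_def] G0(2) by simp_all
  have G_rational: "\<exists>x\<in>G. dot t x \<noteq> 0" if t: "t \<in> V" "t \<noteq> 0" for t
  proof (rule ccontr)
    assume "\<not> ?thesis"
    then have tG: "dot t x = 0" if "x \<in> G" for x using that by blast
    obtain k where "t $ k \<noteq> 0" using t(2) by (auto simp: vec_eq_iff)
    then have p: "dot t (axis k 1) \<noteq> 0" by (simp add: dot_axis)
    \<comment> \<open>The plane and an axis on which \<open>t\<close> is nonzero leave room for a
      further form \<open>f\<close>; then \<open>t\<close> and \<open>f\<close> are independent
      equations of \<open>G\<close>.\<close>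
    have "vec.dim (insert (axis k 1) G) \<le> 4" using G(2) by (simp add: vec.dim_insert)
    moreover have "vec.dim (insert (axis k 1) G) = 5" if "vec.span (insert (axis k 1) G) = UNIV"
      using vec.dim_span[of "insert (axis k 1) G"] that by (simp add: card_cart_basis)
    ultimately have "vec.span (insert (axis k 1) G) \<noteq> UNIV" by auto
    then obtain r where "r \<notin> vec.span (insert (axis k 1) G)" by blast
    then obtain f where f: "\<And>x. x \<in> vec.span (insert (axis k 1) G) \<Longrightarrow> dot f x = 0" "dot f r = 1"
      using functional_separating[OF vec.subspace_span] by blast
    have ker: "x \<in> G \<longleftrightarrow> dot t x = 0 \<and> dot f x = 0" for x
      by (rule common_kernel_eq[OF G tG _ p, of f r]) (use f in \<open>auto intro: vec.span_base\<close>)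
    let ?R = "{pt (vector [dot t v, dot f v] :: 'a ^ 2) | v. v \<in> V \<and> v \<noteq> 0}"
    \<comment> \<open>All vectors with \<open>dot t v = 0\<close> give the single point with
      coordinates 0, 1. The others can be scaled over \<open>F\<close> to
      \<open>dot t v = 1\<close>, which leaves at most \<open>q ^ 4\<close> vectors.\<close>
    have "?R \<subseteq> insert (pt (vector [0, 1])) ((\<lambda>v. pt (vector [1, dot f v])) ` {v \<in> V. dot t v = 1})"
    proof
      fix P assume "P \<in> ?R"
      then obtain v where v: "v \<in> V" "v \<noteq> 0" "P = pt (vector [dot t v, dot f v])" by blast
      show "P \<in> insert (pt (vector [0, 1])) ((\<lambda>v. pt (vector [1, dot f v])) ` {v \<in> V. dot t v = 1})"
      proof (cases "dot t v = 0")
        case True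
        then have "dot f v \<noteq> 0" using ker G_V v by blast
        then have "pt (vector [0, 1]) = P"
          using True v(3) pt_scale[of "dot f v" "vector [0, 1] :: 'a ^ 2"] vector_2_scale[of "dot f v" 0 1] by simp
        then show ?thesis by simp
      next
        case False
        define w where "w = inverse (dot t v) *s v"
        have w: "w \<in> V" "dot t w = 1" "v = dot t v *s w"
          using False v t by (auto simp: w_def intro!: V_closed dot_V_F)
        have "vector [dot t v, dot f v] = dot t v *s (vector [1, dot f w] :: 'a ^ 2)"
          using False by (simp add: w_def vec_eq_iff forall_2)
        then have "P = pt (vector [1, dot f w])" using False v(3) by (simp add: pt_scale)
        then show ?thesis using w by blast
      qed
    qed
    then have "card ?R \<le> card (insert (pt (vector [0, 1] :: 'a ^ 2)) ((\<lambda>v. pt (vector [1, dot f v])) ` {v \<in> V. dot t v = 1}))"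
      by (intro card_mono) auto
    also have "\<dots> \<le> Suc (card ((\<lambda>v. pt (vector [1, dot f v] :: 'a ^ 2)) ` {v \<in> V. dot t v = 1}))"
      by (rule card_insert_le_m1[simplified]) simp_all
    also have "\<dots> \<le> Suc (card {v \<in> V. dot t v = 1})" by (simp add: card_image_le)
    also have "\<dots> \<le> q ^ 4 + 1" using card_affine_hyperplane_le[OF t] by simp
    finally have "card ?R \<le> q ^ 4 + 1" .
    moreover have "card ?R = card L"
      by (rule card_eq_if_PGammaL_equiv[OF equiv[OF ker]]) (auto simp: assms(9))
    moreover have "card L = (q ^ 5 - 1) div (q - 1)" using assms(10) by (simp add: max_scattered_def)
    ultimately show False using scattered_count_gt by simp
  qed
  interpret external_plane q "TYPE('a)" G
    using G G_V G_rational by unfold_locales auto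
  let ?\<sigma> = "induced (frob g 1)"
  have gen: "group_generator (pointwise_stabilizer \<Sigma>) ?\<sigma>"
    by (rule group_generator_frob[OF g \<Sigma>])
  have inter: "\<Gamma> \<inter> (?\<sigma> ^^ i) ` \<Gamma> = {pt (g a)}"
    if "G \<inter> sg i ` G = pt a" "a \<noteq> 0" "i \<le> 5" for a i
    using plane_inter_frob[OF g G0(1) G_def \<Gamma>, of i] that points_of_pt[of "g a"]
    by (simp add: collineation_image_pt[OF g] g_simps)
  have rank: "vec.dim ((\<lambda>j. sg j a) ` {..<5}) = 4 \<and> vec.dim ((\<lambda>j. sg j b) ` {..<5}) = 4"
    if "a \<noteq> 0" "b \<noteq> 0" "G \<inter> sg 4 ` G = pt a" "G \<inter> sg 3 ` G = pt b" for a b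
  proof -
    have "pt_rank ?\<sigma> (pt (g a)) = 4 \<and> pt_rank ?\<sigma> (pt (g b)) = 4"
      using inter[OF that(3,1)] inter[OF that(4,2)] by (intro assms(12)[OF gen]) simp_all
    then show ?thesis using pt_rank_frob[OF g] that(1,2) by simp
  qed
  from rank show ?thesis
  proof (rule classification)
    fix f s assume s: "s \<in> {3, 4::nat}" and f: "bij_betw (dot f) V UNIV" and eqs: "equations f (sg s f)"
    have "PGammaL_equiv L {pt (vector [dot f v, dot (sg s f) v]) | v. v \<in> V \<and> v \<noteq> 0}"
      by (rule equiv[OF G_iff[OF eqs]])
    also have "\<dots> = {pt (vector [x, x ^ (q ^ s)]) | x. x \<noteq> 0}"
      by (rule reparametrise[OF f]) (simp add: dot_sg_V fr_def)
    finally have "pseudoregulus_type q L"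
      unfolding pseudoregulus_type_def using s by (intro exI[of _ s]) (auto simp: gcd_non_0_nat)
    then show ?thesis using assms(11) by blast
  next
    fix f k assume k: "Nm q k = 1" and f: "bij_betw (dot f) V UNIV"
      and eqs: "equations (k *s (sg 1 f + sg 3 f) + sg 2 f + sg 4 f) f"
    let ?h = "k *s (sg 1 f + sg 3 f) + sg 2 f + sg 4 f"
    have "PGammaL_equiv L {pt (vector [dot f v, dot ?h v]) | v. v \<in> V \<and> v \<noteq> 0}"
      by (rule equiv) (use G_iff[OF eqs] in blast)
    also have "\<dots> = {pt (vector [x, F_map q k x]) | x. x \<noteq> 0}"
      by (rule reparametrise[OF f]) (simp add: dot_sg_V fr_def F_map_def distrib_left)
    finally show ?thesis using k by (auto simp: LF_set_def)
  next
    fix f \<eta> \<rho> assume \<eta>\<rho>: "\<eta> \<noteq> 0" "T \<eta> = 0" "T \<rho> \<noteq> 0" and f: "bij_betw (dot f) V UNIV"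
      and eqs: "equations (sg 1 f - sg 4 f) (\<eta> *s (sg 1 f - f) + TV (\<rho> *s f))"
    let ?g1 = "\<eta> *s (sg 1 f - f) + TV (\<rho> *s f)" and ?g2 = "sg 1 f - sg 4 f"
    have "dot (TV (\<rho> *s f)) v = T (\<rho> * dot f v)" if "v \<in> V" for v
      using that by (simp add: dot_commute[of _ v] dot_V_TV)
    note dot_TV = this
    have "PGammaL_equiv L {pt (vector [dot ?g1 v, dot ?g2 v]) | v. v \<in> V \<and> v \<noteq> 0}"
      by (rule equiv) (use G_iff[OF eqs] in blast)
    also have "\<dots> = {pt (vector [\<eta> * (x ^ q - x) + T (\<rho> * x), x ^ q - x ^ (q ^ 4)]) | x. x \<noteq> 0}"
      by (rule reparametrise[OF f]) (simp add: dot_sg_V dot_TV fr_def right_diff_distrib)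
    finally show ?thesis using \<eta>\<rho> by (auto simp: E_set_def)
  qed
qed

end
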